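(* The robust language preservation problem for PTA with one parameter is undecidable; it remains undecidable when the parameter is restricted to range over a bounded interval.
   Context: Clocks are real-valued; parameters take nonnegative rational values. Atomic constraints: $x\sim p+c$, $x\sim c$, $p\sim c$ ($\sim\in\{<,\le,=,\ge,>\}$, $c\in\mathbb Z$); constraints are conjunctions. A PTA $(\Sigma,L,\ell_0,X,P,I,E)$ has invariants $I(\ell)$ and edges $(\ell,g,a,R,\ell')$ (guard, action, reset set). For parameter valuation $v$, $v(\mathcal A)$ is the timed automaton obtained by substituting parameter values, with steps $(\ell,w)\xrightarrow{d,e}(\ell',w')$ for delay $d\ge0$ when $w+d$ satisfies the guard and $w'=(w+d)[R\mapsto0]$ (configurations satisfy invariants). A run is a maximal sequence of steps from $(\ell_0,\mathbf 0)$ (finite only if it ends in a configuration with no outgoing step); $\mathcal L(v(\mathcal A))$ is the set of action sequences of runs (untimed language). The robust (continuous) language preservation problem: given $\mathcal A$ and $v$, decide whether there exists $v'\ne v$ such that $\mathcal L((\lambda v+(1-\lambda)v')(\mathcal A))=\mathcal L(v(\mathcal A))$ for all $\lambda\in[0,1]$. *)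

theory Defs
  imports Complex_Main "HOL-Library.Nat_Bijection"
begin

section \<open>Parametric timed automata\<close>

datatype rel = Lt | Le | Eq | Ge | Gt

fun rel_sem :: "rel \<Rightarrow> real \<Rightarrow> real \<Rightarrow> bool" where
  "rel_sem Lt x y \<longleftrightarrow> x < y"
| "rel_sem Le x y \<longleftrightarrow> x \<le> y"
| "rel_sem Eq x y \<longleftrightarrow> x = y"
| "rel_sem Ge x y \<longleftrightarrow> x \<ge> y"
| "rel_sem Gt x y \<longleftrightarrow> x > y"

text \<open>The atomic constraints \<open>x \<sim> p + c\<close>, \<open>x \<sim> c\<close> and \<open>p \<sim> c\<close>; a constraint is the
  conjunction of a list of them.\<close>

datatype ('x, 'p) atom =
    ClockParam 'x rel 'p int
  | ClockConst 'x rel int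
  | ParamConst 'p rel int

type_synonym ('x, 'p) constraint = "('x, 'p) atom list"

fun atom_clocks :: "('x, 'p) atom \<Rightarrow> 'x set" where
  "atom_clocks (ClockParam x r p c) = {x}"
| "atom_clocks (ClockConst x r c) = {x}"
| "atom_clocks (ParamConst p r c) = {}"

fun atom_params :: "('x, 'p) atom \<Rightarrow> 'p set" where
  "atom_params (ClockParam x r p c) = {p}"
| "atom_params (ClockConst x r c) = {}"
| "atom_params (ParamConst p r c) = {p}"

text \<open>Satisfaction is relative to a real parameter valuation, although the valuations given as
  input are rational: the convex combinations in the robust problem may be irrational.\<close>

fun atom_sat :: "('p \<Rightarrow> real) \<Rightarrow> ('x \<Rightarrow> real) \<Rightarrow> ('x, 'p) atom \<Rightarrow> bool" where
  "atom_sat v w (ClockParam x r p c) \<longleftrightarrow> rel_sem r (w x) (v p + of_int c)"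
| "atom_sat v w (ClockConst x r c) \<longleftrightarrow> rel_sem r (w x) (of_int c)"
| "atom_sat v w (ParamConst p r c) \<longleftrightarrow> rel_sem r (v p) (of_int c)"

definition sat :: "('p \<Rightarrow> real) \<Rightarrow> ('x \<Rightarrow> real) \<Rightarrow> ('x, 'p) constraint \<Rightarrow> bool" where
  "sat v w g \<longleftrightarrow> (\<forall>a\<in>set g. atom_sat v w a)"

record ('a, 'l, 'x, 'p) edge =
  source :: 'l
  guard :: "('x, 'p) constraint"
  label :: 'a
  resets :: "'x list"
  target :: 'l

text \<open>The finite sets of an automaton are given as lists, since automata are inputs of a decision
  problem. Order and repetitions are irrelevant to the semantics.\<close>

record ('a, 'l, 'x, 'p) pta =
  actions :: "'a list"
  locs :: "'l list"
  init :: 'l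
  clocks :: "'x list"
  params :: "'p list"
  invar :: "'l \<Rightarrow> ('x, 'p) constraint"
  edges :: "('a, 'l, 'x, 'p) edge list"

definition constraint_over :: "'x set \<Rightarrow> 'p set \<Rightarrow> ('x, 'p) constraint \<Rightarrow> bool" where
  "constraint_over X P g \<longleftrightarrow> (\<forall>a\<in>set g. atom_clocks a \<subseteq> X \<and> atom_params a \<subseteq> P)"

definition wf_pta :: "('a, 'l, 'x, 'p) pta \<Rightarrow> bool" where
  "wf_pta A \<longleftrightarrow>
     init A \<in> set (locs A) \<and>
     (\<forall>l\<in>set (locs A). constraint_over (set (clocks A)) (set (params A)) (invar A l)) \<and>
     (\<forall>e\<in>set (edges A).
        source e \<in> set (locs A) \<and> target e \<in> set (locs A) \<and> label e \<in> set (actions A) \<and>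
        set (resets e) \<subseteq> set (clocks A) \<and>
        constraint_over (set (clocks A)) (set (params A)) (guard e))"

section \<open>Runs and untimed languages of the instantiated automaton\<close>

type_synonym ('l, 'x) config = "'l \<times> ('x \<Rightarrow> real)"

definition is_config :: "('a, 'l, 'x, 'p) pta \<Rightarrow> ('p \<Rightarrow> real) \<Rightarrow> ('l, 'x) config \<Rightarrow> bool" where
  "is_config A v c \<longleftrightarrow> fst c \<in> set (locs A) \<and> sat v (snd c) (invar A (fst c))"

text \<open>Constraints are convex, so requiring the invariant at both ends of the delay is the same as
  requiring it throughout.\<close>

definition step ::
  "('a, 'l, 'x, 'p) pta \<Rightarrow> ('p \<Rightarrow> real) \<Rightarrow> ('l, 'x) config \<Rightarrow> real \<Rightarrow> ('a, 'l, 'x, 'p) edge \<Rightarrow>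
   ('l, 'x) config \<Rightarrow> bool" where
  "step A v c d e c' \<longleftrightarrow>
     (let u = (\<lambda>x. snd c x + d) in
        d \<ge> 0 \<and> e \<in> set (edges A) \<and> fst c = source e \<and>
        is_config A v c \<and> is_config A v (fst c, u) \<and> sat v u (guard e) \<and>
        c' = (target e, \<lambda>x. if x \<in> set (resets e) then 0 else u x) \<and>
        is_config A v c')"

definition start :: "('a, 'l, 'x, 'p) pta \<Rightarrow> ('l, 'x) config" where
  "start A = (init A, \<lambda>_. 0)"

inductive steps ::
  "('a, 'l, 'x, 'p) pta \<Rightarrow> ('p \<Rightarrow> real) \<Rightarrow> ('l, 'x) config \<Rightarrow> 'a list \<Rightarrow> ('l, 'x) config \<Rightarrow> bool"
  for A v where
  steps_Nil: "steps A v c [] c"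
| steps_Cons: "step A v c d e c' \<Longrightarrow> steps A v c' w c'' \<Longrightarrow> steps A v c (label e # w) c''"

datatype 'a word = Fin "'a list" | Inf "nat \<Rightarrow> 'a"

text \<open>If the initial configuration violates its invariant there is no run at all, not even the
  empty one.\<close>

definition language :: "('a, 'l, 'x, 'p) pta \<Rightarrow> ('p \<Rightarrow> real) \<Rightarrow> 'a word set" where
  "language A v =
     {Fin w | w. is_config A v (start A) \<and>
        (\<exists>c. steps A v (start A) w c \<and> (\<nexists>d e c'. step A v c d e c'))} \<union>
     {Inf s | s. \<exists>c d e. c 0 = start A \<and>
        (\<forall>i. step A v (c i) (d i) (e i) (c (Suc i)) \<and> s i = label (e i))}"

section \<open>Robust language preservation\<close>

definition valuation_in :: "rat set \<Rightarrow> ('a, 'l, 'x, 'p) pta \<Rightarrow> ('p \<Rightarrow> rat) \<Rightarrow> bool" where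
  "valuation_in D A v \<longleftrightarrow> (\<forall>p\<in>set (params A). v p \<in> D)"

text \<open>Valuations are total functions, but only their values on the parameters of the automaton
  are meaningful, hence \<open>v' \<noteq> v\<close> is read on those. \<open>D\<close> is the range of the parameters.\<close>

definition robustly_preservable ::
  "rat set \<Rightarrow> ('a, 'l, 'x, 'p) pta \<Rightarrow> ('p \<Rightarrow> rat) \<Rightarrow> bool" where
  "robustly_preservable D A v \<longleftrightarrow>
     (\<exists>v'. valuation_in D A v' \<and> (\<exists>p\<in>set (params A). v' p \<noteq> v p) \<and>
        (\<forall>t\<in>{0..1::real}.
           language A (\<lambda>p. t * of_rat (v p) + (1 - t) * of_rat (v' p)) =
           language A (\<lambda>p. of_rat (v p))))"

section \<open>Partial recursive functions\<close>

text \<open>Arities are left implicit: a term defines a partial function on argument lists, and its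
  restriction to lists of a fixed length is a partial recursive function of that arity. In \<open>Prim\<close>
  the recursion argument, and in \<open>Mu\<close> the search variable, is the first one.\<close>

datatype recf =
    Zero
  | Succ
  | Proj nat
  | Comp recf "recf list"
  | Prim recf recf
  | Mu recf

inductive computes :: "recf \<Rightarrow> nat list \<Rightarrow> nat \<Rightarrow> bool" where
  computes_Zero: "computes Zero xs 0"
| computes_Succ: "computes Succ [x] (Suc x)"
| computes_Proj: "i < length xs \<Longrightarrow> computes (Proj i) xs (xs ! i)"
| computes_Comp: "list_all2 (\<lambda>g y. computes g xs y) gs ys \<Longrightarrow> computes f ys z \<Longrightarrow>
    computes (Comp f gs) xs z"
| computes_Prim_0: "computes f xs y \<Longrightarrow> computes (Prim f g) (0 # xs) y"
| computes_Prim_Suc: "computes (Prim f g) (n # xs) y \<Longrightarrow> computes g (n # y # xs) z \<Longrightarrow>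
    computes (Prim f g) (Suc n # xs) z"
| computes_Mu: "computes f (n # xs) 0 \<Longrightarrow> (\<And>i. i < n \<Longrightarrow> \<exists>y. computes f (i # xs) (Suc y)) \<Longrightarrow>
    computes (Mu f) xs n"

text \<open>A decision problem consists of an encoding of its instances, the set of instances and the
  set of positive ones. Nothing is required of an algorithm on numbers that encode no instance.\<close>

definition decidable :: "('i \<Rightarrow> nat) \<Rightarrow> 'i set \<Rightarrow> 'i set \<Rightarrow> bool" where
  "decidable enc Inst Pos \<longleftrightarrow>
     (\<exists>f. \<forall>i\<in>Inst. computes f [enc i] (if i \<in> Pos then 1 else 0))"

section \<open>The decision problem\<close>

text \<open>Names are natural numbers, so that automata are finite objects with an effective encoding.
  The invariants are encoded in the order of the locations and the values of the valuation in the
  order of the parameters.\<close>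

type_synonym npta = "(nat, nat, nat, nat) pta"
type_synonym nedge = "(nat, nat, nat, nat) edge"

fun rel_enc :: "rel \<Rightarrow> nat" where
  "rel_enc Lt = 0"
| "rel_enc Le = 1"
| "rel_enc Eq = 2"
| "rel_enc Ge = 3"
| "rel_enc Gt = 4"

fun atom_enc :: "(nat, nat) atom \<Rightarrow> nat" where
  "atom_enc (ClockParam x r p c) = list_encode [0, x, rel_enc r, p, int_encode c]"
| "atom_enc (ClockConst x r c) = list_encode [1, x, rel_enc r, int_encode c]"
| "atom_enc (ParamConst p r c) = list_encode [2, p, rel_enc r, int_encode c]"

definition constraint_enc :: "(nat, nat) constraint \<Rightarrow> nat" where
  "constraint_enc g = list_encode (map atom_enc g)"

definition edge_enc :: "nedge \<Rightarrow> nat" where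
  "edge_enc e = list_encode
     [source e, constraint_enc (guard e), label e, list_encode (resets e), target e]"

definition rat_enc :: "rat \<Rightarrow> nat" where
  "rat_enc q = (case quotient_of q of (m, n) \<Rightarrow> list_encode [int_encode m, int_encode n])"

definition instance_enc :: "npta \<times> (nat \<Rightarrow> rat) \<Rightarrow> nat" where
  "instance_enc = (\<lambda>(A, v). list_encode
     [list_encode (actions A), list_encode (locs A), init A, list_encode (clocks A),
      list_encode (params A), list_encode (map (\<lambda>l. constraint_enc (invar A l)) (locs A)),
      list_encode (map edge_enc (edges A)), list_encode (map (\<lambda>p. rat_enc (v p)) (params A))])"

definition one_param_instances :: "rat set \<Rightarrow> (npta \<times> (nat \<Rightarrow> rat)) set" where
  "one_param_instances D =
     {(A, v). wf_pta A \<and> card (set (params A)) = 1 \<and> valuation_in D A v}"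

definition robust_preservation_decidable :: "rat set \<Rightarrow> bool" where
  "robust_preservation_decidable D \<longleftrightarrow>
     decidable instance_enc (one_param_instances D) {(A, v). robustly_preservable D A v}"

end

theory Submission
  imports Defs
begin

text \<open>The value \<open>a = m / n\<close> of the parameter is to be preserved. For \<open>p\<close> slightly above \<open>a\<close> a
  clock can hold a counter value \<open>c\<close> as \<open>c * (n * p - m)\<close>, so an automaton simulates a given
  counter machine up to a bound that tends to infinity as \<open>p\<close> tends to \<open>a\<close>; for \<open>p = a\<close> the
  simulation is stuck. All actions are 0 until the machine halts, so the language at \<open>a\<close> persists
  on some interval iff the machine does not halt. If the problem were decided by \<open>f\<close>, the
  counter machine could run \<open>f\<close> on the automaton that simulates this very machine, and halt iff
  the answer is positive.\<close>

section \<open>Total recursive functions\<close>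

text \<open>Atomic constraints contain \<open>p\<close> with coefficient 1, and clocks are never
  negative. So \<open>n * p - m\<close>, which vanishes at \<open>a\<close>, is not added at once:
  an increment consists of \<open>n\<close> shifts by \<open>p\<close> and \<open>m\<close> shifts
  by -1, during which the register stays within \<open>m + 1\<close>; hence this bound on the
  clocks. A shift involves only the difference of a duration and a threshold, so both get a common
  offset; \<open>2 * m + 4\<close> makes a missing or repeated reset detectable whenever
  \<open>p \<le> m + 1\<close>. The self-reference needs neither a universal machine nor a recursion
  theorem: the machine receives a number \<open>d\<close> as input, the code of the automaton is a
  simple recursive function of \<open>d\<close>, and \<open>d\<close> is chosen only after the
  program is fixed. Since a decision procedure terminates on every instance, a single finite
  computation is simulated, and the finitely many bounds that it puts on \<open>p\<close> leave a
  whole right neighbourhood of \<open>a\<close>.\<close>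

definition rec_total :: "nat \<Rightarrow> (nat list \<Rightarrow> nat) \<Rightarrow> bool" where
  "rec_total k F \<longleftrightarrow> (\<exists>r. \<forall>xs. length xs = k \<longrightarrow> computes r xs (F xs))"

lemma rec_total_proj: "i < k \<Longrightarrow> rec_total k (\<lambda>xs. xs ! i)"
  unfolding rec_total_def by (intro exI[of _ "Proj i"]) (auto intro: computes_Proj)

lemma rec_total_Suc:
  assumes "rec_total k F"
  shows "rec_total k (\<lambda>xs. Suc (F xs))"
proof -
  obtain r where "\<forall>xs. length xs = k \<longrightarrow> computes r xs (F xs)"
    using assms unfolding rec_total_def by blast
  then have "\<forall>xs. length xs = k \<longrightarrow> computes (Comp Succ [r]) xs (Suc (F xs))"
    by (auto intro!: computes_Comp[where ys = "[_]"] computes_Succ)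
  then show ?thesis unfolding rec_total_def by blast
qed

lemma rec_total_const: "rec_total k (\<lambda>xs. c)"
proof (induction c)
  case 0
  show ?case unfolding rec_total_def by (intro exI[of _ Zero]) (auto intro: computes_Zero)
next
  case (Suc c)
  then show ?case by (rule rec_total_Suc)
qed

lemma rec_total_comp1:
  assumes "rec_total (Suc 0) (\<lambda>xs. h (xs ! 0))" "rec_total k F"
  shows "rec_total k (\<lambda>xs. h (F xs))"
proof -
  obtain r s where r: "\<And>xs. length xs = Suc 0 \<Longrightarrow> computes r xs (h (xs ! 0))"
    and s: "\<And>xs. length xs = k \<Longrightarrow> computes s xs (F xs)"
    using assms unfolding rec_total_def by metis
  have "computes (Comp r [s]) xs (h (F xs))" if "length xs = k" for xs
    by (rule computes_Comp[where ys = "[F xs]"]) (use r[of "[F xs]"] s[OF that] in auto)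
  then show ?thesis unfolding rec_total_def by blast
qed

lemma rec_total_comp2:
  assumes "rec_total 2 (\<lambda>xs. h (xs ! 0) (xs ! 1))" "rec_total k F" "rec_total k G"
  shows "rec_total k (\<lambda>xs. h (F xs) (G xs))"
proof -
  obtain r s t where r: "\<And>xs. length xs = 2 \<Longrightarrow> computes r xs (h (xs ! 0) (xs ! 1))"
    and s: "\<And>xs. length xs = k \<Longrightarrow> computes s xs (F xs)"
    and t: "\<And>xs. length xs = k \<Longrightarrow> computes t xs (G xs)"
    using assms unfolding rec_total_def by metis
  have "computes (Comp r [s, t]) xs (h (F xs) (G xs))" if "length xs = k" for xs
    by (rule computes_Comp[where ys = "[F xs, G xs]"])
      (use r[of "[F xs, G xs]"] s[OF that] t[OF that] in auto)
  then show ?thesis unfolding rec_total_def by blast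
qed

lemma rec_total_prim:
  assumes h: "rec_total 2 (\<lambda>xs. h (xs ! 0) (xs ! 1))"
    and F: "F 0 = c" "\<And>n. F (Suc n) = h n (F n)"
  shows "rec_total (Suc 0) (\<lambda>xs. F (xs ! 0))"
proof -
  obtain r where r: "\<And>xs. length xs = 2 \<Longrightarrow> computes r xs (h (xs ! 0) (xs ! 1))"
    using h unfolding rec_total_def by metis
  obtain s where s: "computes s [] c"
    using rec_total_const[of 0 c] unfolding rec_total_def by auto
  have "computes (Prim s r) [n] (F n)" for n
  proof (induction n)
    case 0
    show ?case using s F(1) by (auto intro: computes_Prim_0)
  next
    case (Suc n)
    show ?case using Suc r[of "[n, F n]"] F(2)[of n] by (auto intro: computes_Prim_Suc)
  qed
  then have "\<forall>xs. length xs = Suc 0 \<longrightarrow> computes (Prim s r) xs (F (xs ! 0))"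
    by (auto simp: length_Suc_conv)
  then show ?thesis unfolding rec_total_def by blast
qed

lemma rec_total_add:
  assumes "rec_total k F" "rec_total k G"
  shows "rec_total k (\<lambda>xs. F xs + G xs)"
proof (rule rec_total_comp2[OF _ assms])
  have "computes (Prim (Proj 0) (Comp Succ [Proj 1])) [x, y] (x + y)" for x y
  proof (induction x)
    case 0
    show ?case using computes_Proj[of 0 "[y]"] by (auto intro: computes_Prim_0)
  next
    case (Suc x)
    have "computes (Comp Succ [Proj 1]) [x, x + y, y] (Suc (x + y))"
      by (rule computes_Comp[where ys = "[x + y]"])
        (use computes_Proj[of 1 "[x, x + y, y]"] in \<open>auto intro: computes_Succ\<close>)
    with Suc show ?case by (auto intro: computes_Prim_Suc)
  qed
  then have "\<forall>xs. length xs = 2 \<longrightarrow>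
      computes (Prim (Proj 0) (Comp Succ [Proj 1])) xs (xs ! 0 + xs ! 1)"
    by (auto simp: length_Suc_conv numeral_2_eq_2)
  then show "rec_total 2 (\<lambda>xs. xs ! 0 + xs ! 1)"
    unfolding rec_total_def by blast
qed

lemma rec_total_mult_const: "rec_total k F \<Longrightarrow> rec_total k (\<lambda>xs. c * F xs)"
  by (induction c) (simp_all add: rec_total_const rec_total_add)

text \<open>The recurrence of \<open>triangle\<close> makes the pairing function recursive by
  addition alone.\<close>

lemma rec_total_prod_encode:
  assumes "rec_total k F" "rec_total k G"
  shows "rec_total k (\<lambda>xs. prod_encode (F xs, G xs))"
proof -
  have "rec_total (Suc 0) (\<lambda>xs. triangle (xs ! 0))"
  proof (rule rec_total_prim)
    show "rec_total 2 (\<lambda>xs. xs ! 1 + Suc (xs ! 0))"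
      by (intro rec_total_add rec_total_Suc rec_total_proj) auto
  qed auto
  then have "rec_total k (\<lambda>xs. triangle (F xs + G xs))"
    by (rule rec_total_comp1) (intro rec_total_add assms)
  then show ?thesis
    unfolding prod_encode_def by (simp add: rec_total_add assms)
qed

lemma rec_total_list_encode_Cons:
  assumes "rec_total k F" "rec_total k (\<lambda>xs. list_encode (G xs))"
  shows "rec_total k (\<lambda>xs. list_encode (F xs # G xs))"
  by (simp add: assms rec_total_Suc rec_total_prod_encode)

text \<open>The descending list is chosen because \<open>rev [0..<Suc n]\<close> is
  \<open>n # rev [0..<n]\<close>: the recursion only puts elements in front.\<close>

lemma rec_total_list_encode_upt:
  "rec_total k F \<Longrightarrow> rec_total k (\<lambda>xs. list_encode (rev [0..<F xs]))"
proof (erule rec_total_comp1[rotated], rule rec_total_prim)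
  show "rec_total 2 (\<lambda>xs. Suc (prod_encode (xs ! 0, xs ! 1)))"
    by (intro rec_total_Suc rec_total_prod_encode rec_total_proj) auto
qed auto

lemma rec_total_list_encode_replicate:
  "rec_total k F \<Longrightarrow> rec_total k (\<lambda>xs. list_encode (replicate (F xs) c))"
proof (erule rec_total_comp1[rotated], rule rec_total_prim)
  show "rec_total 2 (\<lambda>xs. Suc (prod_encode (c, xs ! 1)))"
    by (intro rec_total_Suc rec_total_prod_encode rec_total_proj rec_total_const) auto
qed auto

section \<open>Counter programs\<close>

datatype com =
    Skip
  | Incr nat
  | Decr nat
  | Seq com com
  | While nat com

inductive big_step :: "com \<Rightarrow> (nat \<Rightarrow> nat) \<Rightarrow> (nat \<Rightarrow> nat) \<Rightarrow> bool" where
  big_Skip: "big_step Skip c c"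
| big_Incr: "big_step (Incr i) c (c(i := Suc (c i)))"
| big_Decr: "c i = Suc x \<Longrightarrow> big_step (Decr i) c (c(i := x))"
| big_Seq: "big_step P c c' \<Longrightarrow> big_step Q c' c'' \<Longrightarrow> big_step (Seq P Q) c c''"
| big_While_0: "c i = 0 \<Longrightarrow> big_step (While i P) c c"
| big_While_Suc: "c i > 0 \<Longrightarrow> big_step P c c' \<Longrightarrow> big_step (While i P) c' c'' \<Longrightarrow>
    big_step (While i P) c c''"

section \<open>Clearing, moving and copying registers by loops\<close>

definition clear :: "nat \<Rightarrow> com" where
  "clear i = While i (Decr i)"

lemma big_step_clear: "big_step (clear i) c (c(i := 0))"
proof (induction "c i" arbitrary: c)
  case 0
  then show ?case using big_While_0[of c i] by (simp add: clear_def fun_upd_idem)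
next
  case (Suc x)
  have "big_step (Decr i) c (c(i := x))" by (rule big_Decr) (use Suc(2) in simp)
  with Suc(1)[of "c(i := x)"] Suc(2) show ?case
    unfolding clear_def by (auto intro!: big_While_Suc[of c i])
qed

definition move :: "nat \<Rightarrow> nat \<Rightarrow> com" where
  "move a b = While a (Seq (Decr a) (Incr b))"

lemma big_step_move:
  assumes "a \<noteq> b"
  shows "big_step (move a b) c (c(a := 0, b := c b + c a))"
proof (induction "c a" arbitrary: c)
  case 0
  then show ?case
    using big_While_0[of c a] assms by (simp add: move_def fun_upd_idem)
next
  case (Suc x)
  let ?c = "c(a := x, b := Suc (c b))"
  have "big_step (Seq (Decr a) (Incr b)) c ?c"
    by (rule big_Seq[OF big_Decr[of c a x]]) (use Suc(2) assms big_Incr[of b "c(a := x)"] in auto)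
  moreover have "?c(a := 0, b := ?c b + ?c a) = c(a := 0, b := c b + c a)"
    using assms Suc(2) by auto
  ultimately show ?case
    using Suc(1)[of ?c] Suc(2) assms unfolding move_def by (auto intro!: big_While_Suc[of c a])
qed

definition move2 :: "nat \<Rightarrow> nat \<Rightarrow> nat \<Rightarrow> com" where
  "move2 a b t = While a (Seq (Decr a) (Seq (Incr b) (Incr t)))"

lemma big_step_move2:
  assumes "a \<noteq> b" "a \<noteq> t" "b \<noteq> t"
  shows "big_step (move2 a b t) c (c(a := 0, b := c b + c a, t := c t + c a))"
proof (induction "c a" arbitrary: c)
  case 0
  then show ?case
    using big_While_0[of c a] assms by (simp add: move2_def fun_upd_idem)
next
  case (Suc x)
  let ?c = "c(a := x, b := Suc (c b), t := Suc (c t))"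
  have "big_step (Seq (Decr a) (Seq (Incr b) (Incr t))) c ?c"
    by (rule big_Seq[OF big_Decr[of c a x] big_Seq[OF big_Incr]])
      (use Suc(2) assms big_Incr[of t "c(a := x, b := Suc (c b))"] in auto)
  moreover have "?c(a := 0, b := ?c b + ?c a, t := ?c t + ?c a) = c(a := 0, b := c b + c a, t := c t + c a)"
    using assms Suc(2) by auto
  ultimately show ?case
    using Suc(1)[of ?c] Suc(2) assms unfolding move2_def by (auto intro!: big_While_Suc[of c a])
qed

text \<open>A counter is read by emptying it: its value goes to \<open>b\<close> and to
  \<open>t\<close>, and then back from \<open>t\<close>.\<close>

definition copy :: "nat \<Rightarrow> nat \<Rightarrow> nat \<Rightarrow> com" where
  "copy a b t = Seq (move2 a b t) (move t a)"

lemma big_step_copy: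
  assumes "a \<noteq> b" "a \<noteq> t" "b \<noteq> t" "c t = 0" "c b = 0"
  shows "big_step (copy a b t) c (c(b := c a))"
proof -
  let ?c = "c(a := 0, b := c b + c a, t := c t + c a)"
  have "?c(t := 0, a := ?c a + ?c t) = c(b := c a)" using assms by auto
  then show ?thesis
    unfolding copy_def using big_step_move2[of a b t c] big_step_move[of t a ?c] assms
    by (auto intro: big_Seq)
qed

fun clears :: "nat \<Rightarrow> nat \<Rightarrow> com" where
  "clears n 0 = Skip"
| "clears n (Suc k) = Seq (clear n) (clears (Suc n) k)"

lemma big_step_clears:
  "big_step (clears n k) c (\<lambda>j. if n \<le> j \<and> j < n + k then 0 else c j)"
proof (induction k arbitrary: n c)
  case 0
  have "(\<lambda>j. if n \<le> j \<and> j < n + 0 then 0 else c j) = c" by auto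
  then show ?case using big_Skip[of c] by simp
next
  case (Suc k)
  have "(\<lambda>j. if Suc n \<le> j \<and> j < Suc n + k then 0 else (c(n := 0)) j) =
      (\<lambda>j. if n \<le> j \<and> j < n + Suc k then 0 else c j)"
    by auto
  then show ?case
    using big_Seq[OF big_step_clear[of n c] Suc.IH[of "Suc n" "c(n := 0)"]] by simp
qed

text \<open>The registers from \<open>n\<close> on are scratch space, which is zero before and after execution.\<close>

fun compile :: "recf \<Rightarrow> nat list \<Rightarrow> nat \<Rightarrow> nat \<Rightarrow> com"
  and compiles :: "recf list \<Rightarrow> nat list \<Rightarrow> nat \<Rightarrow> nat \<Rightarrow> com" where
  "compile Zero as out n = Skip"
| "compile Succ as out n = Seq (copy (as ! 0) out n) (Incr out)"
| "compile (Proj i) as out n = copy (as ! i) out n"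
| "compile (Comp f gs) as out n = (let k = n + length gs in
     Seq (compiles gs as n k) (Seq (compile f [n..<k] out k) (clears n (length gs))))"
| "compile (Prim f g) as out n =
     Seq (copy (as ! 0) (n + 3) n)
    (Seq (compile f (tl as) (n + 1) (n + 4))
    (Seq (While (n + 3)
           (Seq (Decr (n + 3))
           (Seq (compile g (n # (n + 1) # tl as) (n + 2) (n + 4))
           (Seq (clear (n + 1))
           (Seq (move (n + 2) (n + 1)) (Incr n))))))
    (Seq (move (n + 1) out) (clear n))))"
| "compile (Mu f) as out n =
     Seq (compile f (n # as) (n + 1) (n + 2))
    (Seq (While (n + 1)
           (Seq (clear (n + 1)) (Seq (Incr n) (compile f (n # as) (n + 1) (n + 2)))))
         (move n out))"
| "compiles [] as out n = Skip"
| "compiles (g # gs) as out n = Seq (compile g as out n) (compiles gs as (Suc out) n)"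

text \<open>All register layouts are covered, since subterms are compiled with other argument,
  output and scratch registers than the whole term.\<close>

definition compile_correct :: "recf \<Rightarrow> nat list \<Rightarrow> nat \<Rightarrow> bool" where
  "compile_correct r xs y \<longleftrightarrow>
     (\<forall>as out n c. map c as = xs \<longrightarrow> set as \<subseteq> {..<n} \<longrightarrow> out < n \<longrightarrow> out \<notin> set as \<longrightarrow>
        c out = 0 \<longrightarrow> (\<forall>j\<ge>n. c j = 0) \<longrightarrow> big_step (compile r as out n) c (c(out := y)))"

lemma compile_correctD:
  assumes "compile_correct r xs y" "map c as = xs" "set as \<subseteq> {..<n}" "out < n" "out \<notin> set as"
    "c out = 0" "\<And>j. j \<ge> n \<Longrightarrow> c j = 0" "c' = c(out := y)"
  shows "big_step (compile r as out n) c c'"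
  using assms unfolding compile_correct_def by blast

text \<open>The scratch space starts at \<open>n\<close>, behind all output registers, so a later
  component cannot spoil the results of earlier ones.\<close>

lemma compiles_correct:
  assumes "list_all2 (\<lambda>g y. compile_correct g xs y) gs ys" "map c as = xs" "set as \<subseteq> {..<out}"
    "out + length gs = n" "\<And>j. j \<ge> out \<Longrightarrow> c j = 0"
  shows "big_step (compiles gs as out n) c
    (\<lambda>j. if out \<le> j \<and> j < n then ys ! (j - out) else c j)"
  using assms
proof (induction gs ys arbitrary: out c rule: list_all2_induct)
  case Nil
  then have "(\<lambda>j. if out \<le> j \<and> j < n then [] ! (j - out) else c j) = c" by auto
  then show ?case using big_Skip[of c] by simp
next
  case (Cons g gs y ys)
  let ?c = "c(out := y)"
  have "set as \<subseteq> {..<n}" "out \<notin> set as" "out < n" "\<And>j. j \<ge> n \<Longrightarrow> c j = 0"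
    using Cons.prems by (auto simp: subset_iff)
  then have 1: "big_step (compile g as out n) c ?c"
    using Cons.hyps(1) Cons.prems by (intro compile_correctD[of g xs y]) auto
  have m: "map ?c as = xs" using \<open>out \<notin> set as\<close> Cons.prems(1) by auto
  have "big_step (compiles gs as (Suc out) n) ?c
      (\<lambda>j. if Suc out \<le> j \<and> j < n then ys ! (j - Suc out) else ?c j)"
    using Cons.prems by (intro Cons.IH) (auto simp: m subset_iff less_Suc_eq)
  moreover have "(\<lambda>j. if Suc out \<le> j \<and> j < n then ys ! (j - Suc out) else ?c j) =
      (\<lambda>j. if out \<le> j \<and> j < n then (y # ys) ! (j - out) else c j)"
    using \<open>out < n\<close> by (auto simp: fun_eq_iff nth_Cons')
  ultimately show ?case using big_Seq[OF 1] by simp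
qed

lemma compile_correct_Comp:
  assumes gs: "list_all2 (\<lambda>g y. compile_correct g xs y) gs ys" and f: "compile_correct f ys z"
  shows "compile_correct (Comp f gs) xs z"
  unfolding compile_correct_def
proof (intro allI impI)
  fix as out n and c :: "nat \<Rightarrow> nat"
  assume c: "map c as = xs" "set as \<subseteq> {..<n}" "out < n" "out \<notin> set as" "c out = 0"
    "\<forall>j\<ge>n. c j = 0"
  let ?k = "n + length gs"
  let ?c = "\<lambda>j. if n \<le> j \<and> j < ?k then ys ! (j - n) else c j"
  have len: "length gs = length ys" using gs by (rule list_all2_lengthD)
  have "big_step (compiles gs as n ?k) c ?c"
    by (rule compiles_correct) (use c gs in auto)
  moreover have "big_step (compile f [n..<?k] out ?k) ?c (?c(out := z))"
    by (rule compile_correctD[OF f]) (use c len in \<open>auto intro: nth_equalityI\<close>)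
  moreover have "big_step (clears n (length gs)) (?c(out := z)) (c(out := z))"
    (is "big_step _ _ ?d")
  proof -
    have "(\<lambda>j. if n \<le> j \<and> j < n + length gs then 0 else (?c(out := z)) j) = ?d"
      using c by (auto simp: fun_eq_iff)
    then show ?thesis using big_step_clears[of n "length gs" "?c(out := z)"] by simp
  qed
  ultimately show "big_step (compile (Comp f gs) as out n) c (c(out := z))"
    by (auto simp: Let_def intro: big_Seq)
qed

text \<open>The compiled loop of \<open>Prim f g\<close> runs upwards from 0, and its invariant
  needs every intermediate value. Correctness of the whole program for a smaller argument does not
  expose them; the sequence \<open>Y\<close> does.\<close>

definition prim_trace :: "recf \<Rightarrow> recf \<Rightarrow> nat list \<Rightarrow> nat \<Rightarrow> bool" where
  "prim_trace f g xs y \<longleftrightarrow> (\<exists>k zs Y. xs = k # zs \<and> Y k = y \<and> compile_correct f zs (Y 0) \<and>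
     (\<forall>i<k. compile_correct g (i # Y i # zs) (Y (Suc i))))"

text \<open>Register \<open>n\<close> holds the index, \<open>n + 1\<close> the current value,
  \<open>n + 2\<close> the next value and \<open>n + 3\<close> the number of iterations
  left.\<close>

lemma compile_correct_Prim:
  assumes "prim_trace f g xs y"
  shows "compile_correct (Prim f g) xs y"
  unfolding compile_correct_def
proof (intro allI impI)
  fix as out n and c :: "nat \<Rightarrow> nat"
  assume c: "map c as = xs" "set as \<subseteq> {..<n}" "out < n" "out \<notin> set as" "c out = 0"
    "\<forall>j\<ge>n. c j = 0"
  obtain k zs Y where xs: "xs = k # zs" and Y: "Y k = y" "compile_correct f zs (Y 0)"
    "\<And>i. i < k \<Longrightarrow> compile_correct g (i # Y i # zs) (Y (Suc i))"
    using assms unfolding prim_trace_def by blast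
  obtain a As where as: "as = a # As" "c a = k" "map c As = zs"
    using c(1) xs by (cases as) auto
  have a: "a < n" "set As \<subseteq> {..<n}" "out \<notin> set As" "a \<noteq> out" using c as by auto
  have "j \<notin> set As" if "j \<ge> n" for j using a(2) that by (meson leD lessThan_iff subsetD)
  then have m: "map (c(n := i, n + 1 := y, n + 3 := q)) As = zs" for i y q
    using as(3) by auto
  let ?S = "\<lambda>i q. c(n := i, n + 1 := Y i, n + 3 := q)"
  let ?body = "Seq (Decr (n + 3)) (Seq (compile g (n # (n + 1) # As) (n + 2) (n + 4))
    (Seq (clear (n + 1)) (Seq (move (n + 2) (n + 1)) (Incr n))))"
  have loop: "big_step (While (n + 3) ?body) (?S i q) (?S k 0)" if "i + q = k" for i q
    using that
  proof (induction q arbitrary: i)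
    case 0
    then have "i = k" by simp
    show ?case unfolding \<open>i = k\<close> by (rule big_While_0) simp
  next
    case (Suc q)
    let ?T = "c(n := i, n + 1 := Y i, n + 3 := q)"
    let ?T2 = "?T(n + 2 := Y (Suc i))" and ?T3 = "?T(n + 2 := Y (Suc i), n + 1 := 0)"
      and ?T4 = "?T(n + 2 := 0, n + 1 := Y (Suc i))"
    have 1: "big_step (Decr (n + 3)) (?S i (Suc q)) ?T"
      using big_Decr[of "?S i (Suc q)" "n + 3" q] by simp
    have 2: "big_step (compile g (n # (n + 1) # As) (n + 2) (n + 4)) ?T ?T2"
      by (rule compile_correctD[OF Y(3)[of i]])
        (use Suc.prems m[of i "Y i" q] a c in \<open>auto simp: subset_iff\<close>)
    have 3: "big_step (clear (n + 1)) ?T2 ?T3" by (rule big_step_clear)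
    have "?T3(n + 2 := 0, n + 1 := ?T3 (n + 1) + ?T3 (n + 2)) = ?T4" by (auto simp: fun_eq_iff)
    then have 4: "big_step (move (n + 2) (n + 1)) ?T3 ?T4"
      using big_step_move[of "n + 2" "n + 1" ?T3] by simp
    have "c (n + 2) = 0" using c(6) by simp
    then have "?T4(n := Suc i) = ?S (Suc i) q" by (intro ext) simp
    moreover have "?T4 n = i" by simp
    ultimately have 5: "big_step (Incr n) ?T4 (?S (Suc i) q)"
      using big_Incr[of n ?T4] by (simp only:)
    have "big_step ?body (?S i (Suc q)) (?S (Suc i) q)"
      by (rule big_Seq[OF 1 big_Seq[OF 2 big_Seq[OF 3 big_Seq[OF 4 5]]]])
    note body = this
    show ?case by (rule big_While_Suc[OF _ body Suc.IH]) (use Suc.prems in simp_all)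
  qed
  let ?c1 = "c(n + 3 := k)"
  have 1: "big_step (copy a (n + 3) n) c ?c1"
    using big_step_copy[of a "n + 3" n c] a c as by auto
  have 2: "big_step (compile f As (n + 1) (n + 4)) ?c1 (?S 0 k)"
  proof (rule compile_correctD[OF Y(2)])
    show "?S 0 k = ?c1(n + 1 := Y 0)" using c by (auto simp: fun_eq_iff)
    show "map ?c1 As = zs" using as(3) a(2) by auto
  qed (use a c in \<open>auto simp: subset_iff\<close>)
  have 4: "big_step (Seq (move (n + 1) out) (clear n)) (?S k 0) (c(out := y))"
  proof -
    have "(?S k 0)(n + 1 := 0, out := (?S k 0) out + (?S k 0) (n + 1), n := 0) = c(out := y)"
      using c Y(1) by (auto simp: fun_eq_iff)
    then show ?thesis
      using big_Seq[OF big_step_move[of "n + 1" out "?S k 0"] big_step_clear[of n]] c by simp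
  qed
  show "big_step (compile (Prim f g) as out n) c (c(out := y))"
    unfolding compile.simps as(1) list.sel nth_Cons_0
    by (rule big_Seq[OF 1 big_Seq[OF 2 big_Seq[OF loop 4]]]) simp
qed

lemma compile_correct_Mu:
  assumes f: "compile_correct f (k # xs) 0"
    and less: "\<And>i. i < k \<Longrightarrow> \<exists>y. compile_correct f (i # xs) (Suc y)"
  shows "compile_correct (Mu f) xs k"
  unfolding compile_correct_def
proof (intro allI impI)
  fix as out n and c :: "nat \<Rightarrow> nat"
  assume c: "map c as = xs" "set as \<subseteq> {..<n}" "out < n" "out \<notin> set as" "c out = 0"
    "\<forall>j\<ge>n. c j = 0"
  obtain Y where Y: "\<And>i. i < k \<Longrightarrow> compile_correct f (i # xs) (Suc (Y i))"
    using less by metis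
  \<comment> \<open>The content of register \<open>n + 1\<close> after candidate \<open>i\<close>
    has been tested; it is 0 only for the result \<open>k\<close>, where the loop ends.\<close>
  define y where "y i = (if i = k then 0 else Suc (Y i))" for i
  let ?f = "compile f (n # as) (n + 1) (n + 2)"
  have f': "big_step ?f (c(n := i)) (c(n := i, n + 1 := y i))" if "i \<le> k" for i
  proof (rule compile_correctD[of f "i # xs" "y i"])
    show "compile_correct f (i # xs) (y i)" using f Y that by (auto simp: y_def)
  qed (use c in auto)
  let ?body = "Seq (clear (n + 1)) (Seq (Incr n) ?f)"
  have loop: "big_step (While (n + 1) ?body) (c(n := i, n + 1 := y i)) (c(n := k))"
    if "i \<le> k" for i
    using that
  proof (induction i rule: inc_induct)
    case base
    have eq: "c(n := k, n + 1 := y k) = c(n := k)" using c by (auto simp: fun_eq_iff y_def)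
    show ?case unfolding eq by (rule big_While_0) (use c in auto)
  next
    case (step i)
    have 1: "big_step (clear (n + 1)) (c(n := i, n + 1 := y i)) (c(n := i))"
    proof -
      have "c(n := i, n + 1 := y i, n + 1 := 0) = c(n := i)" using c by (auto simp: fun_eq_iff)
      then show ?thesis using big_step_clear[of "n + 1" "c(n := i, n + 1 := y i)"] by simp
    qed
    have 2: "big_step (Incr n) (c(n := i)) (c(n := Suc i))"
      using big_Incr[of n "c(n := i)"] by simp
    have 3: "big_step ?body (c(n := i, n + 1 := y i)) (c(n := Suc i, n + 1 := y (Suc i)))"
      using 1 2 f'[of "Suc i"] step by (blast intro: big_Seq Suc_leI)
    show ?case by (rule big_While_Suc[OF _ 3 step.IH]) (use step in \<open>simp add: y_def\<close>)
  qed
  have "c(n := 0) = c" using c by auto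
  then have 1: "big_step ?f c (c(n := 0, n + 1 := y 0))" using f'[of 0] by simp
  have 3: "big_step (move n out) (c(n := k)) (c(out := k))"
  proof -
    have "c(n := k, n := 0, out := (c(n := k)) out + (c(n := k)) n) = c(out := k)"
      using c by (auto simp: fun_eq_iff)
    then show ?thesis using big_step_move[of n out "c(n := k)"] c by simp
  qed
  show "big_step (compile (Mu f) as out n) c (c(out := k))"
    unfolding compile.simps by (rule big_Seq[OF 1 big_Seq[OF loop 3]]) simp
qed

text \<open>The second conjunct strengthens the induction: it passes the trace from one
  \<open>Prim\<close> step to the next.\<close>

lemma computes_compile:
  "computes r xs y \<Longrightarrow>
     compile_correct r xs y \<and> (\<forall>f g. r = Prim f g \<longrightarrow> prim_trace f g xs y)"
proof (induction rule: computes.induct)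
  case (computes_Zero xs)
  then show ?case by (auto simp: compile_correct_def fun_upd_idem intro: big_Skip)
next
  case (computes_Succ x)
  have "big_step (compile Succ as out n) c (c(out := Suc x))"
    if "map c as = [x]" "set as \<subseteq> {..<n}" "out < n" "out \<notin> set as" "c out = 0" "\<forall>j\<ge>n. c j = 0"
    for as out n c
  proof -
    have "map c as = [x]" by fact
    then obtain a where a: "as = [a]" "c a = x" by (cases as) auto
    have "big_step (copy a out n) c (c(out := x))"
      using big_step_copy[of a out n c] that a by auto
    from big_Seq[OF this big_Incr[of out]] show ?thesis using a by simp
  qed
  then show ?case by (auto simp: compile_correct_def simp del: compile.simps)
next
  case (computes_Proj i xs)
  have "big_step (compile (Proj i) as out n) c (c(out := xs ! i))"
    if "map c as = xs" "set as \<subseteq> {..<n}" "out < n" "out \<notin> set as" "c out = 0" "\<forall>j\<ge>n. c j = 0"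
    for as out n c
  proof -
    have "i < length as" using that(1) computes_Proj by auto
    then have "as ! i \<in> set as" "c (as ! i) = xs ! i" using that(1) by auto
    then show ?thesis using big_step_copy[of "as ! i" out n c] that by auto
  qed
  then show ?case by (auto simp: compile_correct_def simp del: compile.simps)
next
  case (computes_Comp xs gs ys f z)
  then show ?case by (auto intro!: compile_correct_Comp elim: list_all2_mono)
next
  case (computes_Prim_0 f xs y g)
  then have "prim_trace f g (0 # xs) y"
    unfolding prim_trace_def by (intro exI[of _ 0] exI[of _ xs] exI[of _ "\<lambda>_. y"]) auto
  then show ?case using compile_correct_Prim by auto
next
  case (computes_Prim_Suc f g n xs y z)
  then obtain Y where Y: "Y n = y" "compile_correct f xs (Y 0)"
    "\<forall>i<n. compile_correct g (i # Y i # xs) (Y (Suc i))"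
    unfolding prim_trace_def by auto
  have "prim_trace f g (Suc n # xs) z"
    unfolding prim_trace_def
    by (intro exI[of _ "Suc n"] exI[of _ xs] exI[of _ "Y(Suc n := z)"])
      (use Y computes_Prim_Suc.IH(2) in \<open>auto simp: less_Suc_eq\<close>)
  then show ?case using compile_correct_Prim by auto
next
  case (computes_Mu f n xs)
  then show ?case by (auto intro!: compile_correct_Mu) blast
qed

lemma big_step_compile:
  assumes "computes r [x] y"
  shows "big_step (compile r [0] 1 2) ((\<lambda>_. 0)(0 := x)) ((\<lambda>_. 0)(0 := x, 1 := y))"
  using computes_compile[OF assms]
  by (auto intro!: compile_correctD[of r "[x]" y])

section \<open>Machines with real registers\<close>

text \<open>A bound \<open>(b, c)\<close> stands for \<open>p + c\<close> or \<open>c\<close>, the right-hand sides of the clock constraints.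
  The last component of a state is the time elapsed so far.\<close>

type_synonym bound = "bool \<times> int"

fun bval :: "real \<Rightarrow> bound \<Rightarrow> real" where
  "bval p (b, c) = (if b then p else 0) + of_int c"

datatype instr =
    Shift nat bound bound
  | Br nat nat nat
  | BrTime nat nat nat
  | Halt

type_synonym state = "nat \<times> (nat \<Rightarrow> real) \<times> real"

text \<open>The range condition of a shift reflects what clocks enforce: they are nonnegative, and
  the exit guard bounds them by \<open>B\<close>. A shift that violates it is stuck, and the
  automaton is then left with its sink.\<close>

inductive exec1 :: "instr list \<Rightarrow> real \<Rightarrow> real \<Rightarrow> state \<Rightarrow> state \<Rightarrow> bool" for Q B p where
  exec1_Shift: "pc < length Q \<Longrightarrow> Q ! pc = Shift i T r \<Longrightarrow> x = R i + bval p T - bval p r \<Longrightarrow>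
    0 \<le> x \<Longrightarrow> x \<le> B \<Longrightarrow> exec1 Q B p (pc, R, s) (Suc pc, R(i := x), s + bval p T)"
| exec1_Br_0: "pc < length Q \<Longrightarrow> Q ! pc = Br i t1 t2 \<Longrightarrow> R i = 0 \<Longrightarrow>
    exec1 Q B p (pc, R, s) (t1, R, s)"
| exec1_Br_pos: "pc < length Q \<Longrightarrow> Q ! pc = Br i t1 t2 \<Longrightarrow> R i > 0 \<Longrightarrow>
    exec1 Q B p (pc, R, s) (t2, R, s)"
| exec1_BrTime_ge: "pc < length Q \<Longrightarrow> Q ! pc = BrTime c t1 t2 \<Longrightarrow> s \<ge> real c \<Longrightarrow>
    exec1 Q B p (pc, R, s) (t1, R, s)"
| exec1_BrTime_less: "pc < length Q \<Longrightarrow> Q ! pc = BrTime c t1 t2 \<Longrightarrow> s < real c \<Longrightarrow>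
    exec1 Q B p (pc, R, s) (t2, R, s)"

abbreviation exec :: "instr list \<Rightarrow> real \<Rightarrow> real \<Rightarrow> state \<Rightarrow> state \<Rightarrow> bool" where
  "exec Q B p \<equiv> (exec1 Q B p)\<^sup>*\<^sup>*"

inductive_cases exec1E: "exec1 Q B p (pc, R, s) c"

lemma exec1_deterministic: "exec1 Q B p c d \<Longrightarrow> exec1 Q B p c d' \<Longrightarrow> d = d'"
  by (induction rule: exec1.induct) (auto elim: exec1E)

lemma exec1_stuck: "length Q \<le> pc \<or> Q ! pc = Halt \<Longrightarrow> \<not> exec1 Q B p (pc, R, s) c"
  by (auto elim: exec1E)

lemma rtranclp_deterministic_stuck:
  assumes "r\<^sup>*\<^sup>* a b" "r\<^sup>*\<^sup>* a c" "\<And>x y z. r x y \<Longrightarrow> r x z \<Longrightarrow> y = z" "\<And>x. \<not> r b x" "\<And>x. \<not> r c x"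
  shows "b = c"
  using assms(1,2)
proof (induction rule: converse_rtranclp_induct)
  case base
  then show ?case using assms(4) by (metis converse_rtranclpE)
next
  case (step y z)
  then show ?case using assms(3,5) by (metis converse_rtranclpE)
qed

text \<open>By determinism all terminal states reachable from \<open>c\<close> coincide, and
  \<open>length Q\<close> is terminal as well as \<open>Halt\<close>.\<close>

lemma exec_not_Halt:
  assumes "exec Q B p c (length Q, R, s)" "exec Q B p c (pc, R', s')" "pc < length Q"
  shows "Q ! pc \<noteq> Halt"
proof
  assume "Q ! pc = Halt"
  then have "(length Q, R, s) = (pc, R', s')"
    by (intro rtranclp_deterministic_stuck[OF assms(1,2)] exec1_stuck)
      (auto dest: exec1_deterministic)
  then show False using assms(3) by simp
qed

definition code_at :: "instr list \<Rightarrow> nat \<Rightarrow> instr list \<Rightarrow> bool" where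
  "code_at Q s P \<longleftrightarrow> (\<exists>pre post. Q = pre @ P @ post \<and> length pre = s)"

lemma code_at_append:
  assumes "code_at Q s (P1 @ P2)"
  shows "code_at Q s P1" "code_at Q (s + length P1) P2"
proof -
  obtain pre post where Q: "Q = pre @ P1 @ P2 @ post" "length pre = s"
    using assms unfolding code_at_def by auto
  show "code_at Q s P1" unfolding code_at_def using Q by blast
  show "code_at Q (s + length P1) P2" unfolding code_at_def
    by (rule exI[of _ "pre @ P1"]) (use Q in auto)
qed

lemma code_at_Cons:
  assumes "code_at Q s (x # P)"
  shows "s < length Q" "Q ! s = x" "code_at Q (Suc s) P"
proof -
  show "s < length Q" "Q ! s = x" using assms unfolding code_at_def by (auto simp: nth_append)
  show "code_at Q (Suc s) P" using assms code_at_append(2)[of Q s "[x]" P] by simp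
qed

text \<open>The valuation to be preserved is \<open>a = m / n\<close>. Near it, a counter with value \<open>c\<close> is
  represented by the register value \<open>c * (n * p - m)\<close>: an increment adds \<open>p\<close> to it
  \<open>n\<close> times and subtracts 1 \<open>m\<close> times.\<close>

definition unit :: "nat \<Rightarrow> nat \<Rightarrow> real \<Rightarrow> real" where
  "unit n m p = real n * p - real m"

definition scaled :: "real \<Rightarrow> (nat \<Rightarrow> nat) \<Rightarrow> nat \<Rightarrow> real" where
  "scaled u c = (\<lambda>j. u * real (c j))"

lemma scaled_upd: "(scaled u c)(i := u * real x) = scaled u (c(i := x))"
  by (auto simp: scaled_def)

section \<open>Increments and decrements as sequences of shifts\<close>

definition inc_code :: "nat \<Rightarrow> nat \<Rightarrow> nat \<Rightarrow> instr list" where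
  "inc_code n m i = (let C = 2 * int m + 4 in
     replicate n (Shift i (True, C) (False, C)) @ replicate m (Shift i (False, C) (False, C + 1)))"

definition dec_code :: "nat \<Rightarrow> nat \<Rightarrow> nat \<Rightarrow> instr list" where
  "dec_code n m i = (let C = 2 * int m + 4 in
     replicate m (Shift i (False, C + 1) (False, C)) @ replicate n (Shift i (False, C) (True, C)))"

lemma length_inc_code [simp]: "length (inc_code n m i) = n + m"
  and length_dec_code [simp]: "length (dec_code n m i) = m + n"
  by (auto simp: inc_code_def dec_code_def Let_def)

lemma exec_replicate_Shift:
  assumes "code_at Q pc (replicate t (Shift i T r))"
    and "\<And>j. j \<le> t \<Longrightarrow>
      0 \<le> R i + real j * (bval p T - bval p r) \<and> R i + real j * (bval p T - bval p r) \<le> B"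
  shows "exec Q B p (pc, R, s)
    (pc + t, R(i := R i + real t * (bval p T - bval p r)), s + real t * bval p T)"
  using assms
proof (induction t)
  case 0
  then show ?case by simp
next
  case (Suc t)
  have Q: "code_at Q pc (replicate t (Shift i T r))" "code_at Q (pc + t) [Shift i T r]"
    using Suc.prems(1) code_at_append[of Q pc "replicate t (Shift i T r)" "[Shift i T r]"]
    by (simp_all add: replicate_append_same)
  let ?x = "\<lambda>j. R i + real j * (bval p T - bval p r)"
  have "exec Q B p (pc, R, s) (pc + t, R(i := ?x t), s + real t * bval p T)"
    by (rule Suc.IH) (use Q Suc.prems(2) in auto)
  moreover have "exec1 Q B p (pc + t, R(i := ?x t), s + real t * bval p T)
      (Suc (pc + t), (R(i := ?x t))(i := ?x (Suc t)), s + real t * bval p T + bval p T)"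
    by (rule exec1_Shift[of _ _ i T r])
      (use code_at_Cons[OF Q(2)] Suc.prems(2)[of "Suc t"] in \<open>auto simp: algebra_simps\<close>)
  ultimately have "exec Q B p (pc, R, s)
      (Suc (pc + t), (R(i := ?x t))(i := ?x (Suc t)), s + real t * bval p T + bval p T)"
    by (rule rtranclp.rtrancl_into_rtrancl)
  moreover have "s + real t * bval p T + bval p T = s + real (Suc t) * bval p T"
    by (simp add: algebra_simps)
  ultimately show ?case by (simp only: fun_upd_upd add_Suc_right)
qed

text \<open>An affine function of \<open>j\<close> is minimal at one of the ends. Thus only the end
  values of a block of shifts have to be checked against the range.\<close>

lemma mult_between:
  fixes x y :: real
  assumes "0 \<le> x" "0 \<le> x + real t * y" "j \<le> t"
  shows "0 \<le> x + real j * y"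
proof (cases "y \<ge> 0")
  case False
  then have "real t * y \<le> real j * y" using assms(3) by (intro mult_right_mono_neg) auto
  then show ?thesis using assms(2) by linarith
qed (use assms in auto)

lemma exec_replicate_Shift':
  assumes "code_at Q pc (replicate t (Shift i T r))"
    and "x = R i + real t * (bval p T - bval p r)"
    and R: "0 \<le> R i" "R i \<le> B" "0 \<le> x" "x \<le> B"
  shows "exec Q B p (pc, R, s) (pc + t, R(i := x), s + real t * bval p T)"
  unfolding assms(2)
proof (rule exec_replicate_Shift[OF assms(1)])
  define y where "y = bval p T - bval p r"
  fix j assume "j \<le> t"
  then have "0 \<le> R i + real j * y" "0 \<le> (B - R i) + real j * (- y)"
    using R assms(2) mult_between[of "R i" t y j] mult_between[of "B - R i" t "- y" j]
    unfolding y_def[symmetric] by simp_all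
  then show "0 \<le> R i + real j * (bval p T - bval p r) \<and> R i + real j * (bval p T - bval p r) \<le> B"
    unfolding y_def[symmetric] by simp
qed

text \<open>From \<open>y\<close> with \<open>y + u \<le> 1\<close> the first block leads to
  \<open>y + n * p = y + u + m \<le> B\<close>, and the second descends by \<open>m\<close>. The
  exact duration is recorded because the input loop is controlled by the elapsed time.\<close>

lemma exec_inc_code:
  assumes "code_at Q pc (inc_code n m i)" and u: "u = unit n m p" "0 \<le> u" "u * real (Suc (c i)) \<le> 1"
    and B: "B = real m + 1"
  shows "exec Q B p (pc, scaled u c, s)
    (pc + (n + m), scaled u (c(i := Suc (c i))), s + real ((n + m) * (2 * m + 4) + m) + u)"
proof -
  let ?C = "2 * int m + 4"
  let ?P1 = "replicate n (Shift i (True, ?C) (False, ?C))"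
  let ?P2 = "replicate m (Shift i (False, ?C) (False, ?C + 1))"
  have Q: "code_at Q pc ?P1" "code_at Q (pc + n) ?P2"
    using code_at_append[of Q pc ?P1 ?P2] assms(1) by (auto simp: inc_code_def Let_def)
  have np: "real n * p = u + real m" using u(1) by (simp add: unit_def)
  define y where "y = u * real (c i)"
  have y: "0 \<le> y" "y + u \<le> 1" "u * real (Suc (c i)) = y + u"
    using u(2,3) by (auto simp: algebra_simps y_def)
  let ?R = "scaled u c" and ?T1 = "bval p (True, ?C)" and ?T2 = "bval p (False, ?C)"
  have R: "?R i = y" by (simp add: scaled_def y_def)
  have T: "?T1 - bval p (False, ?C) = p" "?T2 - bval p (False, ?C + 1) = - 1" by simp_all
  have 1: "exec Q B p (pc, ?R, s) (pc + n, ?R(i := y + u + real m), s + real n * ?T1)"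
    by (rule exec_replicate_Shift'[OF Q(1)], unfold R T)
      (use np y u(2) B in simp_all)
  have 2: "exec Q B p (pc + n, ?R(i := y + u + real m), s + real n * ?T1)
      (pc + n + m, (?R(i := y + u + real m))(i := y + u), s + real n * ?T1 + real m * ?T2)"
    by (rule exec_replicate_Shift'[OF Q(2)], unfold fun_upd_same T)
      (use y u(2) B in simp_all)
  have 3: "(?R(i := y + u + real m))(i := y + u) = scaled u (c(i := Suc (c i)))"
    using scaled_upd[of u c i "Suc (c i)"] y(3) by simp
  have 4: "s + real n * ?T1 + real m * ?T2 = s + real ((n + m) * (2 * m + 4) + m) + u"
  proof -
    have "real n * ?T1 = real n * p + real n * (2 * real m + 4)" by (simp add: distrib_left)
    then show ?thesis unfolding np by (simp add: algebra_simps)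
  qed
  show ?thesis using rtranclp_trans[OF 1 2] unfolding 3 4 add.assoc[of pc n m] .
qed

text \<open>The blocks come in the opposite order: adding \<open>m\<close> first keeps the register
  nonnegative while \<open>n * p\<close> is subtracted.\<close>

lemma exec_dec_code:
  assumes "code_at Q pc (dec_code n m i)" and u: "u = unit n m p" "0 \<le> u" "u * real (c i) \<le> 1"
    and B: "B = real m + 1" and x: "c i = Suc x"
  shows "\<exists>s'. exec Q B p (pc, scaled u c, s) (pc + (m + n), scaled u (c(i := x)), s')"
proof -
  let ?C = "2 * int m + 4"
  let ?P1 = "replicate m (Shift i (False, ?C + 1) (False, ?C))"
  let ?P2 = "replicate n (Shift i (False, ?C) (True, ?C))"
  have Q: "code_at Q pc ?P1" "code_at Q (pc + m) ?P2"
    using code_at_append[of Q pc ?P1 ?P2] assms(1) by (auto simp: dec_code_def Let_def)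
  have np: "real n * p = u + real m" using u(1) by (simp add: unit_def)
  define y where "y = u * real x"
  have y: "0 \<le> y" "y + u \<le> 1"
    using u(2,3) x by (auto simp: algebra_simps y_def)
  let ?R = "scaled u c" and ?T1 = "bval p (False, ?C + 1)" and ?T2 = "bval p (False, ?C)"
  have R: "?R i = y + u" using x by (simp add: scaled_def y_def algebra_simps)
  have T: "?T1 - bval p (False, ?C) = 1" "?T2 - bval p (True, ?C) = - p" by simp_all
  have 1: "exec Q B p (pc, ?R, s) (pc + m, ?R(i := y + u + real m), s + real m * ?T1)"
    by (rule exec_replicate_Shift'[OF Q(1)], unfold R T)
      (use y u(2) B in simp_all)
  have 2: "exec Q B p (pc + m, ?R(i := y + u + real m), s + real m * ?T1)
      (pc + m + n, (?R(i := y + u + real m))(i := y), s + real m * ?T1 + real n * ?T2)"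
    by (rule exec_replicate_Shift'[OF Q(2)], unfold fun_upd_same T)
      (use np y u(2) B in simp_all)
  have 3: "(?R(i := y + u + real m))(i := y) = scaled u (c(i := x))"
    using scaled_upd[of u c i x] y_def by simp
  show ?thesis using rtranclp_trans[OF 1 2] unfolding 3 add.assoc[of pc m n] by (rule exI)
qed

text \<open>Jump targets are absolute, hence the address \<open>s\<close> of the first instruction.
  \<open>Br i s s\<close> serves as an unconditional jump.\<close>

fun assemble :: "nat \<Rightarrow> nat \<Rightarrow> com \<Rightarrow> nat \<Rightarrow> instr list" where
  "assemble n m Skip s = []"
| "assemble n m (Incr i) s = inc_code n m i"
| "assemble n m (Decr i) s = dec_code n m i"
| "assemble n m (Seq P P') s =
     (let Q = assemble n m P s in Q @ assemble n m P' (s + length Q))"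
| "assemble n m (While i P) s =
     (let Q = assemble n m P (Suc s) in Br i (s + length Q + 2) (Suc s) # Q @ [Br i s s])"

lemma exec1_Br:
  assumes "code_at Q s (Br i t1 t2 # P)" "0 \<le> R i"
  shows "exec1 Q B p (s, R, x) (if R i = 0 then t1 else t2, R, x)"
  using code_at_Cons[OF assms(1)] assms(2) by (auto intro: exec1_Br_0 exec1_Br_pos)

lemma eventually_unit_le:
  assumes "n > 0" "0 < e"
  shows "\<forall>\<^sub>F p in at_right (real m / real n). 0 < unit n m p \<and> unit n m p * real x \<le> e"
proof -
  let ?a = "real m / real n"
  have "(unit n m \<longlongrightarrow> unit n m ?a) (at_right ?a)" "unit n m ?a = 0"
    unfolding unit_def using assms(1) by (auto intro!: tendsto_eq_intros)
  then have "((\<lambda>p. unit n m p * real x) \<longlongrightarrow> 0) (at_right ?a)"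
    by (auto intro!: tendsto_eq_intros)
  then have "\<forall>\<^sub>F p in at_right ?a. unit n m p * real x < e"
    using assms(2) by (rule order_tendstoD)
  then show ?thesis using eventually_at_right_less[of ?a]
    by eventually_elim (use assms(1) in \<open>auto simp: unit_def field_simps\<close>)
qed

text \<open>Each counter value of the finite computation bounds \<open>unit n m p\<close> from
  above; the bounds are collected along the derivation. \<open>Q\<close>, \<open>s\<close> and
  \<open>x\<close> are quantified inside the filter because the time \<open>x\<close> at which a
  subprogram starts depends on \<open>p\<close>.\<close>

lemma exec_assemble:
  assumes "big_step P c c'" "n > 0"
  shows "\<forall>\<^sub>F p in at_right (real m / real n). \<forall>Q s x. code_at Q s (assemble n m P s) \<longrightarrow>
    (\<exists>x'. exec Q (real m + 1) p (s, scaled (unit n m p) c, x)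
      (s + length (assemble n m P s), scaled (unit n m p) c', x'))"
  using assms(1)
proof induction
  case (big_Skip c)
  then show ?case by (intro always_eventually) auto
next
  case (big_Incr i c)
  show ?case using eventually_unit_le[of n 1 m "Suc (c i)", OF assms(2) zero_less_one]
  proof eventually_elim
    case (elim p)
    show ?case
    proof (intro allI impI)
      fix Q s x
      assume "code_at Q s (assemble n m (Incr i) s)"
      then have "code_at Q s (inc_code n m i)" by simp
      from exec_inc_code[OF this refl _ _ refl, where p = p and c = c and s = x] elim
      show "\<exists>x'. exec Q (real m + 1) p (s, scaled (unit n m p) c, x)
          (s + length (assemble n m (Incr i) s), scaled (unit n m p) (c(i := Suc (c i))), x')"
        by (auto simp del: of_nat_Suc)
    qed
  qed
next
  case (big_Decr c i x)
  show ?case using eventually_unit_le[of n 1 m "c i", OF assms(2) zero_less_one]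
  proof eventually_elim
    case (elim p)
    show ?case
    proof (intro allI impI)
      fix Q s y
      assume "code_at Q s (assemble n m (Decr i) s)"
      then have "code_at Q s (dec_code n m i)" by simp
      from exec_dec_code[where p = p and s = y and c = c and i = i and x = x, OF this refl _ _ refl big_Decr] elim
      show "\<exists>x'. exec Q (real m + 1) p (s, scaled (unit n m p) c, y)
          (s + length (assemble n m (Decr i) s), scaled (unit n m p) (c(i := x)), x')"
        by auto
    qed
  qed
next
  case (big_Seq P c c' P' c'')
  show ?case using big_Seq.IH
  proof eventually_elim
    case (elim p)
    show ?case
    proof (intro allI impI)
      fix Q s x
      let ?S = "\<lambda>c. scaled (unit n m p) c" and ?l = "length (assemble n m P s)"
      assume "code_at Q s (assemble n m (Seq P P') s)"
      then have Q: "code_at Q s (assemble n m P s)"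
        "code_at Q (s + ?l) (assemble n m P' (s + ?l))"
        using code_at_append by (auto simp: Let_def)
      obtain x1 where 1: "exec Q (real m + 1) p (s, ?S c, x) (s + ?l, ?S c', x1)"
        using elim(1) Q(1) by blast
      obtain x2 where 2: "exec Q (real m + 1) p (s + ?l, ?S c', x1)
          (s + ?l + length (assemble n m P' (s + ?l)), ?S c'', x2)"
        using elim(2) Q(2) by blast
      show "\<exists>x'. exec Q (real m + 1) p (s, ?S c, x)
          (s + length (assemble n m (Seq P P') s), ?S c'', x')"
        using rtranclp_trans[OF 1 2] by (auto simp: Let_def add.assoc)
    qed
  qed
next
  case (big_While_0 c i P)
  show ?case
  proof (intro always_eventually allI impI)
    fix p Q s x
    let ?R = "scaled (unit n m p) c"
    assume "code_at Q s (assemble n m (While i P) s)"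
    moreover have "?R i = 0" using big_While_0 by (simp add: scaled_def)
    ultimately have "exec1 Q (real m + 1) p (s, ?R, x)
        (s + length (assemble n m (While i P) s), ?R, x)"
      using exec1_Br[of Q s i "s + length (assemble n m P (Suc s)) + 2" "Suc s" _ ?R]
      by (auto simp: Let_def)
    then show "\<exists>x'. exec Q (real m + 1) p (s, ?R, x)
        (s + length (assemble n m (While i P) s), ?R, x')" by blast
  qed
next
  case (big_While_Suc c i P c' c'')
  \<comment> \<open>With factor 0 this yields just a positive unit, so that a positive counter has a
    positive register and the loop is entered.\<close>
  show ?case using eventually_unit_le[of n 1 m 0, OF assms(2) zero_less_one] big_While_Suc.IH
  proof eventually_elim
    case (elim p)
    show ?case
    proof (intro allI impI)
      fix Q s x
      let ?S = "\<lambda>c. scaled (unit n m p) c" and ?l = "length (assemble n m P (Suc s))"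
      assume Q: "code_at Q s (assemble n m (While i P) s)"
      then have Q': "code_at Q s (Br i (s + ?l + 2) (Suc s) # (assemble n m P (Suc s) @ [Br i s s]))"
        by (simp add: Let_def)
      note Q2 = code_at_append[OF code_at_Cons(3)[OF Q']]
      have "?S c i > 0" using elim(1) big_While_Suc.hyps by (simp add: scaled_def)
      then have "exec1 Q (real m + 1) p (s, ?S c, x) (Suc s, ?S c, x)"
        using exec1_Br[OF Q', of "?S c"] by simp
      moreover obtain x1 where "exec Q (real m + 1) p (Suc s, ?S c, x) (Suc s + ?l, ?S c', x1)"
        using elim(2) Q2(1) by blast
      moreover have "exec1 Q (real m + 1) p (Suc s + ?l, ?S c', x1) (s, ?S c', x1)"
        using exec1_Br[OF Q2(2), of "?S c'"] elim(1) by (simp add: scaled_def)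
      moreover obtain x2 where "exec Q (real m + 1) p (s, ?S c', x1)
          (s + length (assemble n m (While i P) s), ?S c'', x2)"
        using elim(3) Q by blast
      ultimately have "exec Q (real m + 1) p (s, ?S c, x)
          (s + length (assemble n m (While i P) s), ?S c'', x2)"
        by (meson converse_rtranclp_into_rtranclp rtranclp_trans)
      then show "\<exists>x'. exec Q (real m + 1) p (s, ?S c, x)
          (s + length (assemble n m (While i P) s), ?S c'', x')" by blast
    qed
  qed
qed

fun targets :: "nat \<Rightarrow> instr \<Rightarrow> nat set" where
  "targets pc (Shift i T r) = {Suc pc}"
| "targets pc (Br i t1 t2) = {t1, t2}"
| "targets pc (BrTime c t1 t2) = {t1, t2}"
| "targets pc Halt = {}"

lemma targets_assemble:
  assumes "j < length (assemble n m P s)"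
  shows "targets (s + j) (assemble n m P s ! j) \<subseteq> {..s + length (assemble n m P s)}"
  using assms
proof (induction P arbitrary: s j)
  case (Incr i)
  then show ?case by (auto simp: inc_code_def Let_def nth_append)
next
  case (Decr i)
  then show ?case by (auto simp: dec_code_def Let_def nth_append)
next
  case (Seq P1 P2)
  let ?l = "length (assemble n m P1 s)"
  show ?case
  proof (cases "j < ?l")
    case True
    then show ?thesis using Seq.IH(1)[of j s] by (force simp: Let_def nth_append)
  next
    case False
    then show ?thesis using Seq.IH(2)[of "j - ?l" "s + ?l"] Seq.prems
      by (force simp: Let_def nth_append)
  qed
next
  case (While i P)
  let ?l = "length (assemble n m P (Suc s))"
  consider "j = 0" | "0 < j" "j < Suc ?l" | "j = Suc ?l"
    using While.prems by (force simp: Let_def)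
  then show ?case
  proof cases
    case 2
    then obtain j' where "j = Suc j'" "j' < ?l" by (cases j) auto
    then show ?thesis using While.IH[of j' "Suc s"] by (auto simp: Let_def nth_append)
  qed (auto simp: Let_def nth_append)
qed auto

text \<open>The four cases change the register by \<open>p\<close>, -1, 1 and
  \<open>- p\<close>.\<close>

fun shift_ok :: "nat \<Rightarrow> instr \<Rightarrow> bool" where
  "shift_ok m (Shift i T r) \<longleftrightarrow> (let C = 2 * int m + 4 in
     (T, r) \<in> {((True, C), (False, C)), ((False, C), (False, C + 1)),
       ((False, C + 1), (False, C)), ((False, C), (True, C))})"
| "shift_ok m _ \<longleftrightarrow> True"

lemma shift_ok_inc_code: "ins \<in> set (inc_code n m i) \<Longrightarrow> shift_ok m ins"
  and shift_ok_dec_code: "ins \<in> set (dec_code n m i) \<Longrightarrow> shift_ok m ins"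
  by (auto simp: inc_code_def dec_code_def Let_def)

lemma shift_ok_assemble: "ins \<in> set (assemble n m P s) \<Longrightarrow> shift_ok m ins"
  by (induction P arbitrary: s)
    (auto simp: Let_def shift_ok_inc_code shift_ok_dec_code)

section \<open>From machines to timed automata\<close>

fun bound_atom :: "nat \<Rightarrow> rel \<Rightarrow> bound \<Rightarrow> (nat, nat) atom" where
  "bound_atom x r (b, c) = (if b then ClockParam x r 0 c else ClockConst x r c)"

lemma atom_sat_bound_atom [simp]:
  "atom_sat v w (bound_atom x r b) \<longleftrightarrow> rel_sem r (w x) (bval (v 0) b)"
  by (cases b) auto

lemma atom_clocks_bound_atom [simp]: "atom_clocks (bound_atom x r b) = {x}"
  and atom_params_bound_atom: "q \<in> atom_params (bound_atom x r b) \<Longrightarrow> q = 0"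
  by (cases b; simp split: if_splits)+

declare bound_atom.simps [simp del]

definition mk_edge :: "nat \<Rightarrow> (nat, nat) constraint \<Rightarrow> nat \<Rightarrow> nat list \<Rightarrow> nat \<Rightarrow> nedge" where
  "mk_edge s g a R t = \<lparr>source = s, guard = g, label = a, resets = R, target = t\<rparr>"

lemma mk_edge_sel [simp]:
  "source (mk_edge s g a R t) = s" "guard (mk_edge s g a R t) = g"
  "label (mk_edge s g a R t) = a" "resets (mk_edge s g a R t) = R"
  "target (mk_edge s g a R t) = t"
  by (simp_all add: mk_edge_def)

text \<open>Clock 0 measures the time spent in the current location, clock 1 the total time, and clock
  \<open>j + 2\<close> represents register \<open>j\<close>: it equals the register upon entering a location. In a \<open>Shift\<close>
  location every register clock has to be reset once, when it reaches its threshold; as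
  thresholds and the duration \<open>T\<close> are large compared to \<open>b\<close>, this is enforced by testing that all
  register clocks are at most \<open>b\<close> at time \<open>T\<close>. Location \<open>N\<close> is a sink reachable from everywhere,
  which removes all finite runs, and only \<open>Halt\<close> emits the action 1.\<close>

fun instr_edges :: "nat \<Rightarrow> int \<Rightarrow> nat \<Rightarrow> nat \<Rightarrow> instr \<Rightarrow> nedge list" where
  "instr_edges k b N pc (Shift i T r) =
     mk_edge pc (bound_atom 0 Eq T # map (\<lambda>j. ClockConst (j + 2) Le b) [0..<k]) 0 [0] (Suc pc) #
     mk_edge pc [] 0 [] N #
     map (\<lambda>j. mk_edge pc [bound_atom (j + 2) Eq (if j = i then r else T)] 0 [j + 2] pc) [0..<k]"
| "instr_edges k b N pc (Br i t1 t2) =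
     [mk_edge pc [ClockConst 0 Eq 0, ClockConst (i + 2) Eq 0] 0 [] t1,
      mk_edge pc [ClockConst 0 Eq 0, ClockConst (i + 2) Gt 0] 0 [] t2,
      mk_edge pc [] 0 [] N]"
| "instr_edges k b N pc (BrTime c t1 t2) =
     [mk_edge pc [ClockConst 1 Ge (int c), ClockConst 0 Eq 0] 0 [] t1,
      mk_edge pc [ClockConst 1 Lt (int c), ClockConst 0 Eq 0] 0 [] t2,
      mk_edge pc [] 0 [] N]"
| "instr_edges k b N pc Halt = [mk_edge pc [] 1 [] N, mk_edge pc [] 0 [] N]"

text \<open>The copies of the sink loop do not affect the semantics; they make the edge list long
  enough for its code to exceed the number of clocks in use.\<close>

definition machine_edges :: "nat \<Rightarrow> int \<Rightarrow> instr list \<Rightarrow> nedge list" where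
  "machine_edges k b Q =
     concat (map (\<lambda>pc. instr_edges k b (length Q) pc (Q ! pc)) [0..<length Q]) @
     replicate (k + 2) (mk_edge (length Q) [] 0 [] (length Q))"

text \<open>Locations and clocks are padded to \<open>d\<close> names, so that only the edges depend
  on \<open>Q\<close>, \<open>k\<close> and \<open>b\<close>.\<close>

definition machine_pta :: "nat \<Rightarrow> nat \<Rightarrow> int \<Rightarrow> instr list \<Rightarrow> npta" where
  "machine_pta d k b Q = \<lparr>actions = [0, 1], locs = rev [0..<d], init = 0, clocks = rev [0..<d],
     params = [0], invar = \<lambda>_. [], edges = machine_edges k b Q\<rparr>"

fun registers :: "instr \<Rightarrow> nat set" where
  "registers (Shift i T r) = {i}"
| "registers (Br i t1 t2) = {i}"
| "registers (BrTime c t1 t2) = {}"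
| "registers Halt = {}"

lemma set_machine_edges:
  "set (machine_edges k b Q) =
     (\<Union>pc<length Q. set (instr_edges k b (length Q) pc (Q ! pc))) \<union>
     {mk_edge (length Q) [] 0 [] (length Q)}"
  by (auto simp: machine_edges_def)

lemma sink_edge_in_instr_edges: "mk_edge pc [] 0 [] N \<in> set (instr_edges k b N pc ins)"
  by (cases ins) auto

definition reaches_Halt :: "instr list \<Rightarrow> nat \<Rightarrow> real \<Rightarrow> bool" where
  "reaches_Halt Q m p \<longleftrightarrow>
     (\<exists>pc R x. pc < length Q \<and> Q ! pc = Halt \<and> exec Q (real m + 1) p (0, \<lambda>_. 0, 0) (pc, R, x))"

locale machine =
  fixes Q :: "instr list" and m k d :: nat
  assumes Q_nonempty: "Q \<noteq> []"
    and length_less: "length Q < d" and clocks_le: "k + 2 \<le> d"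
    and shift_ok: "pc < length Q \<Longrightarrow> shift_ok m (Q ! pc)"
    and registers: "pc < length Q \<Longrightarrow> registers (Q ! pc) \<subseteq> {..<k}"
    and targets: "pc < length Q \<Longrightarrow> targets pc (Q ! pc) \<subseteq> {..length Q}"
begin

abbreviation "N \<equiv> length Q"

definition "A = machine_pta d k (int m + 1) Q"

lemma edge_cases:
  assumes "e \<in> set (edges A)"
  obtains pc where "pc < N" "e \<in> set (instr_edges k (int m + 1) N pc (Q ! pc))"
  | "e = mk_edge N [] 0 [] N"
  using assms by (auto simp: A_def machine_pta_def set_machine_edges)

lemma edge_intro:
  "pc < N \<Longrightarrow> e \<in> set (instr_edges k (int m + 1) N pc (Q ! pc)) \<Longrightarrow> e \<in> set (edges A)"
  "mk_edge N [] 0 [] N \<in> set (edges A)"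
  by (auto simp: A_def machine_pta_def set_machine_edges)

lemma edge_wf:
  assumes "e \<in> set (edges A)"
  shows "source e \<le> N" "target e \<le> N" "label e \<in> {0, 1}" "set (resets e) \<subseteq> {..<k + 2}"
    "constraint_over {..<k + 2} {0} (guard e)"
proof -
  have "source e \<le> N \<and> target e \<le> N \<and> label e \<in> {0, 1} \<and> set (resets e) \<subseteq> {..<k + 2} \<and>
    constraint_over {..<k + 2} {0} (guard e)"
    using assms
  proof (cases rule: edge_cases)
    case (1 pc)
    then show ?thesis
      using registers[OF 1(1)] targets[OF 1(1)]
      by (cases "Q ! pc") (auto simp: constraint_over_def dest: atom_params_bound_atom)
  qed (auto simp: constraint_over_def)
  then show "source e \<le> N" "target e \<le> N" "label e \<in> {0, 1}" "set (resets e) \<subseteq> {..<k + 2}"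
    "constraint_over {..<k + 2} {0} (guard e)"
    by blast+
qed

lemma sink_only:
  assumes "e \<in> set (edges A)" "source e = N"
  shows "target e = N" "label e = 0"
proof -
  have "e = mk_edge N [] 0 [] N"
    using assms(1)
  proof (cases rule: edge_cases)
    case (1 pc)
    then show ?thesis using assms(2) by (cases "Q ! pc") auto
  qed
  then show "target e = N" "label e = 0" by auto
qed

lemma wf_A: "wf_pta A"
proof -
  have "constraint_over {..<d} {0} g" if "constraint_over {..<k + 2} {0} g"
    for g :: "(nat, nat) constraint"
    using that clocks_le by (fastforce simp: constraint_over_def)
  then show ?thesis
    using edge_wf length_less clocks_le unfolding wf_pta_def
    by (fastforce simp: A_def machine_pta_def constraint_over_def[of _ _ "[]"] atLeast0LessThan)
qed

end

locale machine_run = machine +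
  fixes p :: real and v :: "nat \<Rightarrow> real"
  assumes p: "0 \<le> p" "p \<le> real m + 1" and v: "v 0 = p"
begin

abbreviation "B \<equiv> real m + 1"

lemma is_config_iff: "is_config A v c \<longleftrightarrow> fst c < d"
  by (auto simp: is_config_def A_def machine_pta_def sat_def)

lemma step_iff:
  "step A v (l, u) \<delta> e c' \<longleftrightarrow> 0 \<le> \<delta> \<and> e \<in> set (edges A) \<and> l = source e \<and>
     sat v (\<lambda>x. u x + \<delta>) (guard e) \<and>
     c' = (target e, \<lambda>x. if x \<in> set (resets e) then 0 else u x + \<delta>)"
  using edge_wf(1,2)[of e] length_less
  by (auto simp: step_def Let_def is_config_iff)

lemma step_mk_edge:
  assumes "mk_edge l g a R t \<in> set (edges A)" "0 \<le> \<delta>" "sat v (\<lambda>x. u x + \<delta>) g"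
    "u' = (\<lambda>x. if x \<in> set R then 0 else u x + \<delta>)"
  shows "step A v (l, u) \<delta> (mk_edge l g a R t) (t, u')"
  using assms by (simp add: step_iff)

lemma step_sink:
  assumes "l \<le> N"
  shows "step A v (l, u) 0 (mk_edge l [] 0 [] N) (N, u)"
proof (rule step_mk_edge)
  show "mk_edge l [] 0 [] N \<in> set (edges A)"
    using assms edge_intro(1)[of l] edge_intro(2) sink_edge_in_instr_edges by (cases "l = N") auto
qed (auto simp: sat_def)

text \<open>The value 0 at other instructions cancels the term for resets, so the formula in
  \<open>simulated\<close> serves all locations.\<close>

definition threshold :: "nat \<Rightarrow> nat \<Rightarrow> real" where
  "threshold l j = (case Q ! l of Shift i T r \<Rightarrow> bval p (if j = i then r else T) | _ \<Rightarrow> 0)"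

text \<open>Durations and thresholds are at least \<open>2 * m + 4 > 2 * B\<close>, and a duration
  exceeds a threshold by at most the maximum of \<open>p\<close> and 1, which is at most
  \<open>B\<close>.\<close>

lemma threshold_Shift:
  assumes "l < N" "Q ! l = Shift i T r"
  shows "B < bval p T" "B < threshold l j" "B + bval p T < 2 * threshold l j"
  using shift_ok[OF assms(1)] p unfolding assms(2) threshold_def by (auto simp: Let_def)

subsection \<open>Soundness\<close>

text \<open>\<open>cnt j\<close> is the number of resets of the clock of register \<open>j\<close> in the current location.\<close>

definition simulated :: "nat \<times> (nat \<Rightarrow> real) \<Rightarrow> bool" where
  "simulated = (\<lambda>(l, u). l < N \<and> (\<exists>R x cnt. exec Q B p (0, \<lambda>_. 0, 0) (l, R, x) \<and>
     (\<forall>j<k. 0 \<le> R j \<and> R j \<le> B) \<and> 0 \<le> u 0 \<and> u 1 = x + u 0 \<and>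
     (\<forall>j<k. 0 \<le> u (j + 2) \<and> u (j + 2) = R j + u 0 - real (cnt j) * threshold l j)))"

text \<open>Without a reset the final value is at least \<open>T > b\<close>; two resets would
  require \<open>2 * t \<le> R + T \<le> b + T\<close>.\<close>

lemma exactly_one_reset:
  fixes t T b R :: real
  assumes "b < T" "b + T < 2 * t" "0 \<le> R" "R \<le> b" "0 \<le> R + T - real c * t" "R + T - real c * t \<le> b"
    "b < t"
  shows "c = 1"
proof -
  have "c \<noteq> 0"
  proof
    assume "c = 0"
    then show False using assms by simp
  qed
  moreover have "\<not> 2 \<le> c"
  proof
    assume "2 \<le> c"
    then have "2 * t \<le> real c * t" using assms by (intro mult_right_mono) auto
    then show False using assms by linarith
  qed
  ultimately show ?thesis by linarith
qed

lemma simulatedI_new: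
  assumes "exec Q B p (0, \<lambda>_. 0, 0) (l, R, x)" "l \<le> N"
    "\<And>j. j < k \<Longrightarrow> 0 \<le> R j \<and> R j \<le> B" "u 0 = 0" "u 1 = x" "\<And>j. j < k \<Longrightarrow> u (j + 2) = R j"
  shows "l = N \<or> simulated (l, u)"
proof -
  have "simulated (l, u)" if "l \<noteq> N"
    unfolding simulated_def prod.case
    by (intro conjI exI[of _ R] exI[of _ x] exI[of _ "\<lambda>_. 0"]) (use that assms in auto)
  then show ?thesis by blast
qed

text \<open>Wrong numbers of resets are not prevented. They only make the exit guard unsatisfiable,
  so such a run stays in the location or moves to the sink and never sees the action 1.\<close>

lemma simulated_step:
  assumes "simulated (l, u)" and st: "step A v (l, u) \<delta> e (l', u')"
  shows "l' = N \<or> simulated (l', u')"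
    and "label e \<noteq> 0 \<Longrightarrow> \<exists>pc R x. pc < N \<and> Q ! pc = Halt \<and> exec Q B p (0, \<lambda>_. 0, 0) (pc, R, x)"
proof -
  obtain R x cnt where l: "l < N" and ex: "exec Q B p (0, \<lambda>_. 0, 0) (l, R, x)"
    and R: "\<And>j. j < k \<Longrightarrow> 0 \<le> R j \<and> R j \<le> B" and u: "0 \<le> u 0" "u 1 = x + u 0"
    and uj: "\<And>j. j < k \<Longrightarrow> 0 \<le> u (j + 2) \<and> u (j + 2) = R j + u 0 - real (cnt j) * threshold l j"
    using assms(1) unfolding simulated_def by auto
  have \<delta>: "0 \<le> \<delta>" and e: "e \<in> set (edges A)" and src: "source e = l"
    and g: "sat v (\<lambda>x. u x + \<delta>) (guard e)" and l': "l' = target e"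
    and u': "u' = (\<lambda>x. if x \<in> set (resets e) then 0 else u x + \<delta>)"
    using st by (auto simp: step_iff)
  have e': "e \<in> set (instr_edges k (int m + 1) N l (Q ! l))"
    using e
  proof (cases rule: edge_cases)
    case (1 pc)
    moreover from 1(2) have "source e = pc" by (cases "Q ! pc") auto
    ultimately show ?thesis using src by simp
  qed (use src l in auto)
  show "\<exists>pc R x. pc < N \<and> Q ! pc = Halt \<and> exec Q B p (0, \<lambda>_. 0, 0) (pc, R, x)" if "label e \<noteq> 0"
    using that e' l ex by (cases "Q ! l") auto
  show "l' = N \<or> simulated (l', u')"
  proof (cases "Q ! l")
    case (Shift i T r)
    note thr = threshold_Shift[OF l Shift]
    have i: "i < k" using registers[OF l] Shift by simp
    consider (exit) "guard e = bound_atom 0 Eq T # map (\<lambda>j. ClockConst (j + 2) Le (int m + 1)) [0..<k]"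
        "resets e = [0]" "target e = Suc l"
      | (sink) "target e = N"
      | (reset) j where "j < k" "guard e = [bound_atom (j + 2) Eq (if j = i then r else T)]"
        "resets e = [j + 2]" "target e = l"
      using e' unfolding Shift by auto
    then show ?thesis
    proof cases
      case exit
      have T: "u 0 + \<delta> = bval p T" and le: "\<And>j. j < k \<Longrightarrow> u (j + 2) + \<delta> \<le> B"
        using g v unfolding exit by (auto simp: sat_def)
      have val: "u (j + 2) + \<delta> = R j + bval p T - threshold l j" if "j < k" for j
      proof -
        have "u (j + 2) + \<delta> = R j + bval p T - real (cnt j) * threshold l j"
          using uj[OF that] T by simp
        moreover from this have "cnt j = 1"
          using exactly_one_reset[of B "bval p T" "threshold l j" "R j" "cnt j"]
            thr R[OF that] uj[OF that] le[OF that] \<delta> by auto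
        ultimately show ?thesis by simp
      qed
      let ?x = "R i + bval p T - bval p r"
      have x: "?x = u (i + 2) + \<delta>" using val[OF i] Shift by (simp add: threshold_def)
      have R': "(R(i := ?x)) j = u (j + 2) + \<delta>" if "j < k" for j
        using val[OF that] x Shift by (auto simp: threshold_def)
      have "exec1 Q B p (l, R, x) (Suc l, R(i := ?x), x + bval p T)"
        by (rule exec1_Shift[OF l Shift refl]) (use x uj[OF i] \<delta> le[OF i] in auto)
      with ex have "exec Q B p (0, \<lambda>_. 0, 0) (Suc l, R(i := ?x), x + bval p T)"
        by (rule rtranclp.rtrancl_into_rtrancl)
      then show ?thesis unfolding l' exit
      proof (rule simulatedI_new)
        show "Suc l \<le> N" using l by simp
        show "0 \<le> (R(i := ?x)) j \<and> (R(i := ?x)) j \<le> B" if "j < k" for j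
          unfolding R'[OF that] using uj[OF that] \<delta> le[OF that] by simp
        show "u' 0 = 0" "u' 1 = x + bval p T" using T u by (auto simp: u' exit)
        show "u' (j + 2) = (R(i := ?x)) j" if "j < k" for j
          unfolding R'[OF that] by (simp add: u' exit)
      qed
    next
      case sink
      then show ?thesis using l' by simp
    next
      case (reset j)
      have "u (j + 2) + \<delta> = threshold l j"
        using g v Shift unfolding reset by (auto simp: sat_def threshold_def)
      then have thr_j: "0 = R j + (u 0 + \<delta>) - real (Suc (cnt j)) * threshold l j"
        using uj[OF reset(1)] by (simp add: distrib_right)
      have "0 \<le> u' (j' + 2) \<and>
          u' (j' + 2) = R j' + u' 0 - real ((cnt(j := Suc (cnt j))) j') * threshold l j'"
        if "j' < k" for j'
      proof (cases "j' = j")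
        case True
        then show ?thesis using thr_j by (simp add: u' reset del: of_nat_Suc)
      next
        case False
        then have "u' (j' + 2) = u (j' + 2) + \<delta>" "u' 0 = u 0 + \<delta>" by (simp_all add: u' reset)
        then show ?thesis using uj[OF that] \<delta> False by simp
      qed
      moreover have "0 \<le> u' 0" "u' 1 = x + u' 0" using u \<delta> by (auto simp: u' reset)
      ultimately show ?thesis using l ex R unfolding l' reset simulated_def by blast
    qed
  next
    case (Br i t1 t2)
    have i: "i < k" using registers[OF l] Br by simp
    show ?thesis
    proof (cases "target e = N")
      case False
      \<comment> \<open>A target other than \<open>N\<close> excludes the sink edge; the guards of
        the other edges force zero delay.\<close>
      then have "u 0 + \<delta> = 0"
        and gr: "u (i + 2) + \<delta> = 0 \<and> target e = t1 \<or> u (i + 2) + \<delta> > 0 \<and> target e = t2"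
        and res: "resets e = []"
        using e' g unfolding Br by (auto simp: sat_def)
      then have [simp]: "u 0 = 0" "\<delta> = 0" using u \<delta> by auto
      have u'_u: "u' = u" by (simp add: u' res)
      have ur: "u (j + 2) = R j" if "j < k" for j
        using uj[OF that] Br by (simp add: threshold_def)
      have "exec1 Q B p (l, R, x) (target e, R, x)"
        using gr ur[OF i] exec1_Br_0[OF l Br] exec1_Br_pos[OF l Br] by auto
      with ex have "exec Q B p (0, \<lambda>_. 0, 0) (target e, R, x)"
        by (rule rtranclp.rtrancl_into_rtrancl)
      then show ?thesis unfolding l' u'_u
        by (rule simulatedI_new) (use edge_wf(2)[OF e] R u ur in auto)
    qed (simp add: l')
  next
    case (BrTime c t1 t2)
    show ?thesis
    proof (cases "target e = N")
      case False
      then have "u 0 + \<delta> = 0"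
        and gr: "u 1 + \<delta> \<ge> real c \<and> target e = t1 \<or> u 1 + \<delta> < real c \<and> target e = t2"
        and res: "resets e = []"
        using e' g unfolding BrTime by (auto simp: sat_def)
      then have [simp]: "u 0 = 0" "\<delta> = 0" using u \<delta> by auto
      have u'_u: "u' = u" by (simp add: u' res)
      have ur: "u (j + 2) = R j" if "j < k" for j
        using uj[OF that] BrTime by (simp add: threshold_def)
      have "exec1 Q B p (l, R, x) (target e, R, x)"
        using gr u(2) exec1_BrTime_ge[OF l BrTime] exec1_BrTime_less[OF l BrTime] by auto
      with ex have "exec Q B p (0, \<lambda>_. 0, 0) (target e, R, x)"
        by (rule rtranclp.rtrancl_into_rtrancl)
      then show ?thesis unfolding l' u'_u
        by (rule simulatedI_new) (use edge_wf(2)[OF e] R u ur in auto)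
    qed (simp add: l')
  next
    case Halt
    then show ?thesis using e' l' by auto
  qed
qed

subsection \<open>Completeness\<close>

definition encodes :: "(nat \<Rightarrow> real) \<Rightarrow> real \<Rightarrow> (nat \<Rightarrow> real) \<Rightarrow> bool" where
  "encodes R x u \<longleftrightarrow> u 0 = 0 \<and> u 1 = x \<and> (\<forall>j<k. u (j + 2) = R j)"

text \<open>\<open>U\<close> contains the registers whose clock is still to be reset, which is due
  at time \<open>threshold l j - R j\<close>. Resetting in the order of due times keeps all delays
  nonnegative, and no due time exceeds the duration because \<open>R' j \<ge> 0\<close>.\<close>

lemma steps_Shift:
  assumes l: "l < N" and Shift: "Q ! l = Shift i T r"
    and R: "\<And>j. j < k \<Longrightarrow> 0 \<le> R j \<and> R j \<le> B"
    and R': "\<And>j. j < k \<Longrightarrow> 0 \<le> R' j \<and> R' j \<le> B \<and> R' j = R j + bval p T - threshold l j"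
    and U: "U \<subseteq> {..<k}" "u 1 = x + u 0" "u 0 \<le> bval p T"
      "\<And>j. j < k \<Longrightarrow> u (j + 2) = R j + u 0 - (if j \<in> U then 0 else threshold l j)"
      "\<And>j. j \<in> U \<Longrightarrow> u 0 \<le> threshold l j - R j"
  shows "\<exists>w u'. steps A v (l, u) w (Suc l, u') \<and> encodes R' (x + bval p T) u'"
  using U
proof (induction "card U" arbitrary: U u)
  case 0
  then have "U = {}" using finite_subset[OF 0(2)] by auto
  let ?\<delta> = "bval p T - u 0"
  let ?g = "bound_atom 0 Eq T # map (\<lambda>j. ClockConst (j + 2) Le (int m + 1)) [0..<k]"
  let ?u = "\<lambda>y. if y \<in> set [0] then 0 else u y + ?\<delta>"
  have u: "u (j + 2) + ?\<delta> = R' j" if "j < k" for j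
    using 0(5)[OF that] R'[OF that] \<open>U = {}\<close> by simp
  have "step A v (l, u) ?\<delta> (mk_edge l ?g 0 [0] (Suc l)) (Suc l, ?u)"
  proof (rule step_mk_edge[OF _ _ _ refl])
    show "mk_edge l ?g 0 [0] (Suc l) \<in> set (edges A)"
      by (rule edge_intro(1)[OF l]) (simp add: Shift)
    have "u (j + 2) + ?\<delta> \<le> B" if "j < k" for j
      using u[OF that] R'[OF that] by linarith
    then show "sat v (\<lambda>y. u y + ?\<delta>) ?g" by (auto simp: v sat_def)
  qed (use 0 in simp)
  from steps_Cons[OF this steps_Nil]
  have "steps A v (l, u) [0] (Suc l, ?u)" by simp
  moreover have "encodes R' (x + bval p T) ?u" using u 0 by (auto simp: encodes_def)
  ultimately show ?case by blast
next
  case (Suc n)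
  define f where "f j = threshold l j - R j" for j
  have fin: "finite U" "U \<noteq> {}" using finite_subset[OF Suc(3)] Suc(2) by auto
  define j where "j = arg_min_on f U"
  have j: "j \<in> U" "\<And>j'. j' \<in> U \<Longrightarrow> f j \<le> f j'"
    using arg_min_if_finite[OF fin, of f] unfolding j_def by force+
  have jk: "j < k" using j Suc(3) by auto
  let ?\<delta> = "f j - u 0"
  let ?u = "\<lambda>y. if y \<in> set [j + 2] then 0 else u y + ?\<delta>"
  have \<delta>: "?\<delta> \<ge> 0" using Suc(7)[OF j(1)] by (simp add: f_def)
  have st: "step A v (l, u) ?\<delta>
      (mk_edge l [bound_atom (j + 2) Eq (if j = i then r else T)] 0 [j + 2] l) (l, ?u)"
  proof (rule step_mk_edge[OF _ _ _ refl])
    show "mk_edge l [bound_atom (j + 2) Eq (if j = i then r else T)] 0 [j + 2] l \<in> set (edges A)"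
      by (rule edge_intro(1)[OF l]) (use jk in \<open>simp add: Shift\<close>)
    have "threshold l j = bval p (if j = i then r else T)" by (simp add: threshold_def Shift)
    then show "sat v (\<lambda>y. u y + ?\<delta>) [bound_atom (j + 2) Eq (if j = i then r else T)]"
      using Suc(6)[OF jk] j(1) v by (simp add: sat_def f_def)
  qed (use \<delta> in simp)
  have "\<exists>w u'. steps A v (l, ?u) w (Suc l, u') \<and> encodes R' (x + bval p T) u'"
  proof (rule Suc(1)[of "U - {j}"])
    show "n = card (U - {j})" using Suc(2) j(1) fin by simp
    show "U - {j} \<subseteq> {..<k}" using Suc(3) by auto
    show "?u 1 = x + ?u 0" using Suc(4) by simp
    show "?u 0 \<le> bval p T" using R'[OF jk] by (simp add: f_def)
    show "?u (j' + 2) = R j' + ?u 0 - (if j' \<in> U - {j} then 0 else threshold l j')"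
      if "j' < k" for j'
      using Suc(6)[OF that] by (cases "j' = j") (simp_all add: f_def)
    show "?u 0 \<le> threshold l j' - R j'" if "j' \<in> U - {j}" for j'
      using j(2)[of j'] that by (simp add: f_def)
  qed
  then show ?case using steps_Cons[OF st] by blast
qed

lemma steps_exec1:
  assumes "exec1 Q B p (pc, R, x) (pc', R', x')" "encodes R x u" "\<And>j. j < k \<Longrightarrow> 0 \<le> R j \<and> R j \<le> B"
  shows "(\<exists>w u'. steps A v (pc, u) w (pc', u') \<and> encodes R' x' u') \<and>
    (\<forall>j<k. 0 \<le> R' j \<and> R' j \<le> B)"
  using assms(1)
proof (rule exec1E, goal_cases)
  case (1 i T r)
  note thr = threshold_Shift[OF 1(2,3)]
  have R': "0 \<le> R' j \<and> R' j \<le> B \<and> R' j = R j + bval p T - threshold pc j" if "j < k" for j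
    using 1 assms(3)[OF that] by (auto simp: threshold_def)
  have "\<exists>w u'. steps A v (pc, u) w (Suc pc, u') \<and> encodes R' (x + bval p T) u'"
    using assms(2,3) thr
    by (intro steps_Shift[where U = "{..<k}", OF 1(2,3) assms(3) R'])
      (auto simp: encodes_def, smt (verit))
  moreover have "pc' = Suc pc" "x' = x + bval p T" using 1(1) by simp_all
  ultimately show ?case using R' by blast
next
  case (2 i t1 t2)
  have i: "i < k" using registers[OF 2(2)] 2(3) by simp
  have "step A v (pc, u) 0 (mk_edge pc [ClockConst 0 Eq 0, ClockConst (i + 2) Eq 0] 0 [] pc') (pc', u)"
    by (rule step_mk_edge, rule edge_intro(1)) (use 2 assms(2) i in \<open>auto simp: sat_def encodes_def\<close>)
  from steps_Cons[OF this steps_Nil] show ?case using 2 assms(2,3) by fastforce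
next
  case (3 i t1 t2)
  have i: "i < k" using registers[OF 3(2)] 3(3) by simp
  have "step A v (pc, u) 0 (mk_edge pc [ClockConst 0 Eq 0, ClockConst (i + 2) Gt 0] 0 [] pc') (pc', u)"
    by (rule step_mk_edge, rule edge_intro(1)) (use 3 assms(2) i in \<open>auto simp: sat_def encodes_def\<close>)
  from steps_Cons[OF this steps_Nil] show ?case using 3 assms(2,3) by fastforce
next
  case (4 c t1 t2)
  have "step A v (pc, u) 0 (mk_edge pc [ClockConst 1 Ge (int c), ClockConst 0 Eq 0] 0 [] pc') (pc', u)"
    by (rule step_mk_edge, rule edge_intro(1)) (use 4 assms(2) in \<open>auto simp: sat_def encodes_def\<close>)
  from steps_Cons[OF this steps_Nil] show ?case using 4 assms(2,3) by fastforce
next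
  case (5 c t1 t2)
  have "step A v (pc, u) 0 (mk_edge pc [ClockConst 1 Lt (int c), ClockConst 0 Eq 0] 0 [] pc') (pc', u)"
    by (rule step_mk_edge, rule edge_intro(1)) (use 5 assms(2) in \<open>auto simp: sat_def encodes_def\<close>)
  from steps_Cons[OF this steps_Nil] show ?case using 5 assms(2,3) by fastforce
qed

lemma steps_append: "steps A v c w c' \<Longrightarrow> steps A v c' w' c'' \<Longrightarrow> steps A v c (w @ w') c''"
  by (induction rule: steps.induct) (auto intro: steps_Cons)

lemma steps_exec:
  assumes "exec Q B p (0, \<lambda>_. 0, 0) s"
  shows "\<exists>w u. steps A v (start A) w (fst s, u) \<and> encodes (fst (snd s)) (snd (snd s)) u \<and>
    (\<forall>j<k. 0 \<le> fst (snd s) j \<and> fst (snd s) j \<le> B)"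
  using assms
proof (induction rule: rtranclp_induct)
  case base
  have "start A = (0, \<lambda>_. 0)" by (simp add: start_def A_def machine_pta_def)
  then show ?case using steps_Nil[of A v] by (auto simp: encodes_def)
next
  case (step y z)
  obtain pc R x pc' R' x' where yz: "y = (pc, R, x)" "z = (pc', R', x')"
    by (metis surj_pair)
  then obtain w u where "steps A v (start A) w (pc, u)" "encodes R x u" "\<forall>j<k. 0 \<le> R j \<and> R j \<le> B"
    using step.IH by auto
  moreover from this obtain w' u' where "steps A v (pc, u) w' (pc', u')" "encodes R' x' u'"
      "\<forall>j<k. 0 \<le> R' j \<and> R' j \<le> B"
    using steps_exec1[of pc R x pc' R' x' u] step.hyps(2) yz by auto
  ultimately show ?case using steps_append[of "start A" w "(pc, u)" w' "(pc', u')"] yz by auto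
qed

subsection \<open>Languages\<close>

definition infinite_run :: "nat \<times> (nat \<Rightarrow> real) \<Rightarrow> (nat \<Rightarrow> nat) \<Rightarrow> bool" where
  "infinite_run c0 s \<longleftrightarrow> (\<exists>c \<delta> e. c 0 = c0 \<and>
     (\<forall>i. step A v (c i) (\<delta> i) (e i) (c (Suc i)) \<and> s i = label (e i)))"

lemma infinite_run_Cons:
  assumes "step A v c0 \<delta> e c1" "infinite_run c1 s"
  shows "infinite_run c0 (case_nat (label e) s)"
proof -
  obtain c \<delta>' e' where "c 0 = c1" "\<forall>i. step A v (c i) (\<delta>' i) (e' i) (c (Suc i)) \<and> s i = label (e' i)"
    using assms(2) unfolding infinite_run_def by blast
  then show ?thesis unfolding infinite_run_def
    by (intro exI[of _ "case_nat c0 c"] exI[of _ "case_nat \<delta> \<delta>'"] exI[of _ "case_nat e e'"])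
      (use assms(1) in \<open>auto split: nat.splits\<close>)
qed

text \<open>It suffices to keep track of the range, since only the occurrence of the action 1
  matters, not its position.\<close>

lemma infinite_run_steps:
  "steps A v c w c' \<Longrightarrow> infinite_run c' s \<Longrightarrow> \<exists>s'. infinite_run c s' \<and> range s \<subseteq> range s'"
proof (induction rule: steps.induct)
  case (steps_Cons c d e c' w c'')
  then obtain s' where s': "infinite_run c' s'" "range s \<subseteq> range s'" by blast
  have "range s' \<subseteq> range (case_nat (label e) s')"
    by (auto intro: image_eqI[of _ _ "Suc _"])
  then show ?case using infinite_run_Cons[OF steps_Cons(1) s'(1)] s'(2) by blast
qed auto

lemma infinite_run_sink: "infinite_run (N, u) (\<lambda>_. 0)"
  unfolding infinite_run_def
  by (intro exI[of _ "\<lambda>_. (N, u)"] exI[of _ "\<lambda>_. 0"] exI[of _ "\<lambda>_. mk_edge N [] 0 [] N"])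
    (simp add: step_sink)

lemma infinite_run_zero: "l \<le> N \<Longrightarrow> infinite_run (l, u) (\<lambda>_. 0)"
proof -
  assume "l \<le> N"
  have "case_nat 0 (\<lambda>_. 0) = (\<lambda>_. 0 :: nat)" by (auto split: nat.splits)
  then show ?thesis using infinite_run_Cons[OF step_sink[OF \<open>l \<le> N\<close>] infinite_run_sink] by simp
qed

lemma start_A: "start A = (0, \<lambda>_. 0)"
  by (simp add: start_def A_def machine_pta_def)

definition invariant :: "nat \<times> (nat \<Rightarrow> real) \<Rightarrow> bool" where
  "invariant c \<longleftrightarrow> fst c = N \<or> simulated c"

lemma invariant_start: "invariant (start A)"
  using simulatedI_new[of 0 "\<lambda>_. 0" 0 "\<lambda>_. 0"] by (simp add: invariant_def start_A)

lemma invariant_le: "invariant c \<Longrightarrow> fst c \<le> N"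
  by (auto simp: invariant_def simulated_def)

lemma invariant_step:
  assumes "invariant c" "step A v c \<delta> e c'"
  shows "invariant c' \<and> (label e \<noteq> 0 \<longrightarrow> reaches_Halt Q m p)"
proof (cases "fst c = N")
  case True
  moreover have "step A v (fst c, snd c) \<delta> e c'" using assms(2) by simp
  ultimately have "source e = N" "e \<in> set (edges A)" "fst c' = target e"
    unfolding step_iff by auto
  then show ?thesis using sink_only[of e] by (simp add: invariant_def)
next
  case False
  then have "simulated (fst c, snd c)" using assms(1) by (simp add: invariant_def)
  then show ?thesis
    using simulated_step[of "fst c" "snd c" \<delta> e "fst c'" "snd c'"] assms(2)
    by (auto simp: invariant_def reaches_Halt_def)
qed

lemma invariant_steps: "steps A v c w c' \<Longrightarrow> invariant c \<Longrightarrow> invariant c'"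
  by (induction rule: steps.induct) (auto dest: invariant_step)

lemma infinite_run_no_halt:
  assumes "infinite_run (start A) s" "\<not> reaches_Halt Q m p"
  shows "s = (\<lambda>_. 0)"
proof -
  obtain c \<delta> e where c: "c 0 = start A" "\<And>i. step A v (c i) (\<delta> i) (e i) (c (Suc i))"
    "\<And>i. s i = label (e i)"
    using assms(1) unfolding infinite_run_def by blast
  have "invariant (c i)" for i
  proof (induction i)
    case 0
    show ?case using c(1) invariant_start by simp
  next
    case (Suc i)
    then show ?case using invariant_step[OF _ c(2)] by blast
  qed
  then show ?thesis using invariant_step[OF _ c(2)] c(3) assms(2) by auto
qed

lemma Inf_in_language: "Inf s \<in> language A v \<longleftrightarrow> infinite_run (start A) s"
  unfolding language_def infinite_run_def by auto

text \<open>Every location has an unguarded edge to the sink, so no reachable configuration is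
  blocked.\<close>

lemma Fin_notin_language: "Fin w \<notin> language A v"
proof
  assume "Fin w \<in> language A v"
  then obtain c where "steps A v (start A) w c" "\<nexists>d e c'. step A v c d e c'"
    unfolding language_def by auto
  then show False
    using invariant_steps[OF _ invariant_start] invariant_le[of c] step_sink[of "fst c" "snd c"]
    by auto
qed

lemma language_no_halt:
  assumes "\<not> reaches_Halt Q m p"
  shows "language A v = {Inf (\<lambda>_. 0)}"
proof (intro set_eqI)
  fix w
  show "w \<in> language A v \<longleftrightarrow> w \<in> {Inf (\<lambda>_. 0)}"
    using infinite_run_no_halt[OF _ assms] infinite_run_zero[of 0] Fin_notin_language
    by (cases w) (auto simp: Inf_in_language start_A)
qed

lemma language_halt:
  assumes "reaches_Halt Q m p"
  shows "language A v \<noteq> {Inf (\<lambda>_. 0)}"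
proof -
  obtain pc R x where pc: "pc < N" "Q ! pc = Halt" "exec Q B p (0, \<lambda>_. 0, 0) (pc, R, x)"
    using assms unfolding reaches_Halt_def by blast
  obtain w u where w: "steps A v (start A) w (pc, u)" using steps_exec[OF pc(3)] by auto
  have "step A v (pc, u) 0 (mk_edge pc [] 1 [] N) (N, u)"
    by (rule step_mk_edge, rule edge_intro(1)[OF pc(1)]) (auto simp: pc(2) sat_def)
  from infinite_run_Cons[OF this infinite_run_sink]
  have "infinite_run (pc, u) (case_nat 1 (\<lambda>_. 0))" by simp
  from infinite_run_steps[OF w this] obtain s' where
    s': "infinite_run (start A) s'" "range (case_nat 1 (\<lambda>_. 0 :: nat)) \<subseteq> range s'"
    by blast
  have "1 \<in> range (case_nat 1 (\<lambda>_. 0 :: nat))" by (rule range_eqI[of _ _ 0]) simp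
  then have "s' \<noteq> (\<lambda>_. 0)" using s'(2) by auto
  then show ?thesis using s'(1) Inf_in_language[of s'] by auto
qed

end

section \<open>The reduction\<close>

text \<open>One traversal of the loop at address 0 increments register 0 and takes time
  \<open>loop_time n m + unit n m p\<close>. If \<open>p\<close> is close to \<open>m / n\<close>, the test \<open>BrTime\<close> therefore leaves the
  loop exactly when register 0 represents \<open>d\<close>, and the input \<open>d\<close> occurs in the automaton only
  through the constant in this test.\<close>

definition loop_time :: "nat \<Rightarrow> nat \<Rightarrow> nat" where
  "loop_time n m = (n + m) * (2 * m + 4) + m"

text \<open>Register 0 holds the input and register 1 the result. \<open>Br 0 0 0\<close> closes the
  input loop. The next branch ends the program if the unit is 0, the only case in which a positive
  input is represented by 0. Address \<open>N\<close> is the sink of the automaton.\<close>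

definition program_tail :: "nat \<Rightarrow> nat \<Rightarrow> com \<Rightarrow> instr list" where
  "program_tail n m P = (let t = n + m + 2; l = length (assemble n m P (Suc t)); N = t + l + 3 in
     inc_code n m 0 @ [Br 0 0 0, Br 0 N (Suc t)] @ assemble n m P (Suc t) @
     [Br 1 N (t + l + 2), Halt])"

definition program :: "nat \<Rightarrow> nat \<Rightarrow> com \<Rightarrow> nat \<Rightarrow> instr list" where
  "program n m P d = BrTime (loop_time n m * d) (n + m + 2) 1 # program_tail n m P"

lemma length_program:
  "length (program n m P d) = n + m + length (assemble n m P (n + m + 3)) + 5"
  by (simp add: program_def program_tail_def Let_def numeral_3_eq_3)

lemma code_at_program:
  fixes n m P d
  defines "Q \<equiv> program n m P d" and "t \<equiv> n + m + 2"
  shows "code_at Q 0 [BrTime (loop_time n m * d) t 1]" "code_at Q 1 (inc_code n m 0)"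
    "code_at Q (n + m + 1) [Br 0 0 0]" "code_at Q t [Br 0 (length Q) (Suc t)]"
    "code_at Q (Suc t) (assemble n m P (Suc t))"
    "code_at Q (Suc t + length (assemble n m P (Suc t)))
       [Br 1 (length Q) (t + length (assemble n m P (Suc t)) + 2)]"
    "t + length (assemble n m P (Suc t)) + 2 < length Q"
    "Q ! (t + length (assemble n m P (Suc t)) + 2) = Halt"
proof -
  let ?l = "length (assemble n m P (Suc t))"
  have len: "length Q = t + ?l + 3"
    unfolding Q_def t_def by (simp add: length_program numeral_3_eq_3)
  have Q: "Q = [] @ ([BrTime (loop_time n m * d) t 1] @ inc_code n m 0 @ [Br 0 0 0] @
      [Br 0 (length Q) (Suc t)] @ assemble n m P (Suc t) @
      [Br 1 (length Q) (t + ?l + 2)] @ [Halt]) @ []" (is "Q = [] @ ?Q @ []")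
    unfolding len by (simp add: Q_def t_def program_def program_tail_def Let_def)
  have 0: "code_at Q 0 ?Q" unfolding code_at_def using Q by blast
  note 1 = code_at_append[OF 0]
  note 2 = code_at_append[OF 1(2)]
  note 3 = code_at_append[OF 2(2)]
  note 4 = code_at_append[OF 3(2)]
  note 5 = code_at_append[OF 4(2)]
  note 6 = code_at_append[OF 5(2)]
  note 7 = code_at_Cons[OF 6(2)]
  show "code_at Q 0 [BrTime (loop_time n m * d) t 1]" by (rule 1)
  show "code_at Q 1 (inc_code n m 0)" using 2(1) by simp
  show "code_at Q (n + m + 1) [Br 0 0 0]" using 3(1) by simp
  show "code_at Q t [Br 0 (length Q) (Suc t)]" using 4(1) by (simp add: t_def)
  show "code_at Q (Suc t) (assemble n m P (Suc t))" using 5(1) by (simp add: t_def)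
  show "code_at Q (Suc t + ?l) [Br 1 (length Q) (t + ?l + 2)]" using 6(1) by (simp add: t_def)
  show "t + ?l + 2 < length Q" "Q ! (t + ?l + 2) = Halt" using 7(1,2) by (simp_all add: t_def)
qed

lemma code_at_nth: "code_at Q s P \<Longrightarrow> j < length P \<Longrightarrow> Q ! (s + j) = P ! j"
  unfolding code_at_def by (auto simp: nth_append)

lemma exec_input:
  fixes n m P d
  defines "Q \<equiv> program n m P d"
  assumes n: "n > 0" and u: "u = unit n m p" "0 \<le> u" "u * real d \<le> 1"
  shows "\<exists>x. exec Q (real m + 1) p (0, \<lambda>_. 0, 0) (n + m + 2, scaled u ((\<lambda>_. 0)(0 := d)), x)"
proof -
  let ?S = "\<lambda>i. scaled u ((\<lambda>_. 0)(0 := i))" and ?K = "loop_time n m"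
  note code = code_at_program[of n m P d, folded Q_def]
  note head = code_at_Cons(1,2)[OF code(1)]
  have loop: "exec Q (real m + 1) p (0, \<lambda>_. 0, 0) (0, ?S i, real i * (real ?K + u))" if "i \<le> d" for i
    using that
  proof (induction i)
    case 0
    have "?S 0 = (\<lambda>_. 0)" by (auto simp: scaled_def)
    show ?case unfolding \<open>?S 0 = (\<lambda>_. 0)\<close> by simp
  next
    case (Suc i)
    let ?x = "real i * (real ?K + u)"
    have ui: "u * real (Suc i) \<le> 1" using Suc.prems u(2,3) mult_left_mono[of "real (Suc i)" "real d" u]
      by simp
    have "?x < real (?K * d)"
    proof -
      have "real ?K * real (Suc i) \<le> real ?K * real d" using Suc.prems by (intro mult_left_mono) auto
      \<comment> \<open>This exceeds the accumulated drift \<open>u * i \<le> 1\<close>, so the loop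
        is not left a round too early.\<close>
      moreover have "real ?K \<ge> 4" using n by (cases n) (auto simp: loop_time_def)
      moreover have "u * real i \<le> 1" using ui u(2) by (simp add: algebra_simps)
      ultimately show ?thesis by (simp add: algebra_simps)
    qed
    then have 1: "exec1 Q (real m + 1) p (0, ?S i, ?x) (1, ?S i, ?x)"
      by (rule exec1_BrTime_less[OF head])
    have upd: "((\<lambda>_. 0)(0 := i))(0 := Suc (((\<lambda>_. 0)(0 := i)) 0)) = ((\<lambda>_. 0)(0 := Suc i) :: nat \<Rightarrow> nat)"
      by auto
    have 2: "exec Q (real m + 1) p (1, ?S i, ?x) (1 + (n + m), ?S (Suc i), ?x + real ?K + u)"
      using exec_inc_code[OF code(2) u(1,2) _ refl, where c = "(\<lambda>_. 0)(0 := i)" and s = ?x] ui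
      unfolding upd loop_time_def by simp
    have "?S (Suc i) 0 \<ge> 0" using u(2) by (simp add: scaled_def)
    then have 3: "exec1 Q (real m + 1) p (1 + (n + m), ?S (Suc i), ?x + real ?K + u)
        (0, ?S (Suc i), ?x + real ?K + u)"
      using exec1_Br[OF code(3), of "?S (Suc i)"] by simp
    have "exec Q (real m + 1) p (0, \<lambda>_. 0, 0) (0, ?S (Suc i), ?x + real ?K + u)"
      using Suc.IH Suc.prems 1 2 3
      by (meson Suc_leD rtranclp.rtrancl_into_rtrancl rtranclp_trans)
    moreover have "?x + real ?K + u = real (Suc i) * (real ?K + u)" by (simp add: algebra_simps)
    ultimately show ?case by (simp only:)
  qed
  have "exec1 Q (real m + 1) p (0, ?S d, real d * (real ?K + u))
      (n + m + 2, ?S d, real d * (real ?K + u))"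
    by (rule exec1_BrTime_ge[OF head]) (use u(2) in \<open>simp add: algebra_simps\<close>)
  with loop[of d] show ?thesis by (meson order_refl rtranclp.rtrancl_into_rtrancl)
qed

lemma not_reaches_Halt:
  assumes "exec Q (real m + 1) p (0, \<lambda>_. 0, 0) (length Q, R, x)"
  shows "\<not> reaches_Halt Q m p"
  using exec_not_Halt[OF assms] unfolding reaches_Halt_def by blast

text \<open>The input loop is controlled by time alone and is left even if the unit is 0; register 0
  is then 0, and the next branch ends the program.\<close>

lemma not_reaches_Halt_program:
  assumes "n > 0" "p = real m / real n"
  shows "\<not> reaches_Halt (program n m P d) m p"
proof -
  let ?Q = "program n m P d"
  have "0 = unit n m p" using assms by (simp add: unit_def)
  from exec_input[OF assms(1) this] obtain x where
    "exec ?Q (real m + 1) p (0, \<lambda>_. 0, 0) (n + m + 2, scaled 0 ((\<lambda>_. 0)(0 := d)), x)"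
    by auto
  moreover have "exec1 ?Q (real m + 1) p (n + m + 2, scaled 0 ((\<lambda>_. 0)(0 := d)), x)
      (length ?Q, scaled 0 ((\<lambda>_. 0)(0 := d)), x)"
    using exec1_Br[OF code_at_program(4), of "scaled 0 ((\<lambda>_. 0)(0 := d))"] by (simp add: scaled_def)
  ultimately show ?thesis
    using not_reaches_Halt by (meson rtranclp.rtrancl_into_rtrancl)
qed

text \<open>A positive unit and \<open>d > 0\<close> pass the test behind the input loop. The output
  register then selects \<open>Halt\<close> or the end of the program, and the latter excludes
  \<open>Halt\<close> by determinism.\<close>

lemma eventually_reaches_Halt_iff:
  assumes n: "n > 0" and d: "d > 0" and P: "big_step P ((\<lambda>_. 0)(0 := d)) ((\<lambda>_. 0)(0 := d, 1 := y))"
  shows "\<forall>\<^sub>F p in at_right (real m / real n). reaches_Halt (program n m P d) m p \<longleftrightarrow> y > 0"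
  using exec_assemble[OF P n] eventually_unit_le[OF n zero_less_one, of m d]
proof eventually_elim
  case (elim p)
  let ?Q = "program n m P d" and ?t = "n + m + 2" and ?B = "real m + 1"
  let ?l = "length (assemble n m P (Suc ?t))" and ?u = "unit n m p"
  let ?S1 = "scaled ?u ((\<lambda>_. 0)(0 := d))" and ?S2 = "scaled ?u ((\<lambda>_. 0)(0 := d, 1 := y))"
  note code = code_at_program[of n m P d]
  obtain x where "exec ?Q ?B p (0, \<lambda>_. 0, 0) (?t, ?S1, x)"
    using exec_input[OF n refl, where P = P and d = d and m = m and p = p] elim(2) by auto
  moreover have "exec1 ?Q ?B p (?t, ?S1, x) (Suc ?t, ?S1, x)"
    using exec1_Br[OF code(4), of ?S1] elim(2) d by (simp add: scaled_def)
  moreover obtain x' where "exec ?Q ?B p (Suc ?t, ?S1, x) (Suc ?t + ?l, ?S2, x')"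
    using elim(1) code(5) by blast
  ultimately have 1: "exec ?Q ?B p (0, \<lambda>_. 0, 0) (Suc ?t + ?l, ?S2, x')"
    by (meson rtranclp.rtrancl_into_rtrancl rtranclp_trans)
  have 2: "exec1 ?Q ?B p (Suc ?t + ?l, ?S2, x') (if y = 0 then length ?Q else ?t + ?l + 2, ?S2, x')"
    using exec1_Br[OF code(6), of ?S2] elim(2) by (auto simp: scaled_def)
  have 3: "exec ?Q ?B p (0, \<lambda>_. 0, 0) (if y = 0 then length ?Q else ?t + ?l + 2, ?S2, x')"
    using 1 2 by (rule rtranclp.rtrancl_into_rtrancl)
  show ?case
  proof (cases "y = 0")
    case True
    then show ?thesis using 3 not_reaches_Halt by auto
  next
    case False
    then show ?thesis using 3 code(7,8) unfolding reaches_Halt_def by auto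
  qed
qed

section \<open>The code of the automaton as a recursive function of the input\<close>

definition edges_tail :: "nat \<Rightarrow> int \<Rightarrow> instr list \<Rightarrow> nedge list" where
  "edges_tail k b Q = mk_edge 0 [] 0 [] (Suc (length Q)) #
     concat (map (\<lambda>pc. instr_edges k b (Suc (length Q)) pc (Q ! (pc - 1))) [1..<Suc (length Q)]) @
     replicate (k + 2) (mk_edge (Suc (length Q)) [] 0 [] (Suc (length Q)))"

definition time_edge :: "rel \<Rightarrow> nat \<Rightarrow> nat \<Rightarrow> nedge" where
  "time_edge r c t = mk_edge 0 [ClockConst 1 r (int c), ClockConst 0 Eq 0] 0 [] t"

text \<open>The edges that contain \<open>c\<close> are moved to the head of the list.
  \<open>Q\<close> lacks the first instruction, hence the shifted indices in
  \<open>edges_tail\<close>.\<close>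

lemma machine_edges_BrTime:
  "machine_edges k b (BrTime c t1 t2 # Q) =
     time_edge Ge c t1 # time_edge Lt c t2 # edges_tail k b Q"
proof -
  have "[0..<Suc (length Q)] = 0 # [1..<Suc (length Q)]" by (rule upt_conv_Cons[of 0, simplified One_nat_def[symmetric]]) simp
  then show ?thesis
    by (auto simp: machine_edges_def edges_tail_def time_edge_def nth_Cons' intro!: arg_cong[of _ _ concat])
qed

lemma length_concat_ge: "(\<And>x. x \<in> set xs \<Longrightarrow> f x \<noteq> []) \<Longrightarrow> length xs \<le> length (concat (map f xs))"
proof (induction xs)
  case (Cons x xs)
  then have "length (f x) \<ge> 1" "length xs \<le> length (concat (map f xs))"
    by (auto simp: Suc_le_eq)
  then show ?case by (simp del: One_nat_def)
qed simp

text \<open>Each instruction contributes at least its sink edge. As a list is no longer than its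
  code, the number \<open>d\<close> that encodes these edges bounds the locations and clocks in
  use.\<close>

lemma length_edges_tail: "length Q + k + 3 \<le> length (edges_tail k b Q)"
proof -
  have "length [1..<Suc (length Q)] \<le> length (concat (map (\<lambda>pc. instr_edges k b (Suc (length Q)) pc
      (Q ! (pc - 1))) [1..<Suc (length Q)]))"
    by (rule length_concat_ge) (metis empty_iff empty_set sink_edge_in_instr_edges)
  then have "length Q \<le> length (concat (map (\<lambda>pc. instr_edges k b (Suc (length Q)) pc
      (Q ! (pc - 1))) [1..<Suc (length Q)]))"
    by (simp only: length_upt)
  then show ?thesis unfolding edges_tail_def by (simp del: upt_Suc length_concat)
qed

lemma length_le_list_encode: "length xs \<le> list_encode xs"
proof (induction xs)
  case (Cons x xs)
  then show ?case using le_prod_encode_2[of "list_encode xs" x] by simp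
qed simp

text \<open>The code of \<open>x # xs\<close> is
  \<open>Suc (prod_encode (x, list_encode xs))\<close>, so \<open>d\<close> in tail position
  supplies all remaining edges without being decoded. Neither the program nor the number of
  registers occurs here.\<close>

definition reduction :: "nat \<Rightarrow> nat \<Rightarrow> rat \<Rightarrow> nat \<Rightarrow> nat" where
  "reduction n m a d = list_encode
     [list_encode [0, 1], list_encode (rev [0..<d]), 0, list_encode (rev [0..<d]), list_encode [0],
      list_encode (replicate d 0),
      Suc (prod_encode (edge_enc (time_edge Ge (loop_time n m * d) (n + m + 2)),
        Suc (prod_encode (edge_enc (time_edge Lt (loop_time n m * d) 1), d)))),
      list_encode [rat_enc a]]"

lemma rec_total_time_edge:
  assumes "rec_total k F"
  shows "rec_total k (\<lambda>xs. edge_enc (time_edge r (F xs) t))"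
proof -
  have int: "int_encode (int x) = 2 * x" for x by (simp add: int_encode_def sum_encode_def)
  show ?thesis
    unfolding edge_enc_def constraint_enc_def time_edge_def mk_edge_sel list.map atom_enc.simps int
    by (intro rec_total_list_encode_Cons rec_total_const rec_total_mult_const assms)
qed

lemma rec_total_reduction: "rec_total (Suc 0) (\<lambda>xs. reduction n m a (xs ! 0))"
  unfolding reduction_def
  by (intro rec_total_list_encode_Cons rec_total_const rec_total_list_encode_upt
      rec_total_list_encode_replicate rec_total_Suc rec_total_prod_encode rec_total_time_edge
      rec_total_mult_const rec_total_proj) auto

lemma instance_enc_machine_pta:
  assumes "d = list_encode (map edge_enc (edges_tail k b Q))"
  shows "instance_enc (machine_pta d k b (BrTime (loop_time n m * d) (n + m + 2) 1 # Q), \<lambda>_. a) =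
    reduction n m a d"
proof -
  have "map (\<lambda>l. constraint_enc []) (rev [0..<d]) = replicate d 0"
    by (simp add: constraint_enc_def map_replicate_const)
  then show ?thesis
    unfolding instance_enc_def machine_pta_def reduction_def machine_edges_BrTime assms[symmetric]
    by (simp add: assms[symmetric])
qed

lemma machine_program:
  assumes "\<And>ins. ins \<in> set (program_tail n m P) \<Longrightarrow> registers ins \<subseteq> {..<k}"
    and d: "length (program_tail n m P) + k + 3 \<le> d"
  shows "machine (program n m P d) m k d"
proof
  let ?t = "n + m + 2"
  let ?l = "length (assemble n m P (Suc ?t))"
  note code = code_at_program[of n m P d]
  show "program n m P d \<noteq> []" "length (program n m P d) < d" "k + 2 \<le> d"
    using d by (auto simp: program_def)
  fix pc assume pc: "pc < length (program n m P d)"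
  then have in_set: "program n m P d ! pc \<in> set (program n m P d)" by simp
  then show "shift_ok m (program n m P d ! pc)"
    by (auto simp: program_def program_tail_def Let_def shift_ok_inc_code shift_ok_assemble)
  show "registers (program n m P d ! pc) \<subseteq> {..<k}"
    using in_set assms(1) by (fastforce simp: program_def)
  show "targets pc (program n m P d ! pc) \<subseteq> {..length (program n m P d)}"
  proof -
    consider "pc = 0" | j where "pc = 1 + j" "j < n + m" | "pc = n + m + 1" | "pc = ?t"
      | j where "pc = Suc ?t + j" "j < ?l" | "pc = Suc ?t + ?l" | "pc = ?t + ?l + 2"
    proof -
      have "pc < ?t + ?l + 3" using pc by (simp add: length_program numeral_3_eq_3)
      then have "pc = 0 \<or> (\<exists>j. pc = 1 + j \<and> j < n + m) \<or> pc = n + m + 1 \<or> pc = ?t \<or>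
          (\<exists>j. pc = Suc ?t + j \<and> j < ?l) \<or> pc = Suc ?t + ?l \<or> pc = ?t + ?l + 2"
        by presburger
      then show ?thesis using that by blast
    qed
    then show ?thesis
    proof cases
      case 1
      then show ?thesis using length_program[of n m P d] by (simp add: program_def)
    next
      case (2 j)
      have "program n m P d ! (1 + j) = assemble n m (Incr 0) 1 ! j"
        unfolding assemble.simps by (rule code_at_nth[OF code(2)]) (use 2 in simp)
      then show ?thesis
        using targets_assemble[of j n m "Incr 0" 1] 2 length_program[of n m P d] by auto
    next
      case 3
      show ?thesis using code_at_Cons(2)[OF code(3)] unfolding 3 by simp
    next
      case 4
      show ?thesis using code_at_Cons(2)[OF code(4)] pc unfolding 4 by simp
    next
      case (5 j)
      then show ?thesis
        using targets_assemble[OF 5(2)] code_at_nth[OF code(5) 5(2)] code(7) by auto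
    next
      case 6
      show ?thesis using code_at_Cons(2)[OF code(6)] code(7) unfolding 6 by simp
    next
      case 7
      show ?thesis using code(8) unfolding 7 by simp
    qed
  qed
qed

lemma computes_reduction: "\<exists>r. \<forall>d. computes r [d] (reduction n m a d)"
proof -
  obtain r where "\<And>xs. length xs = Suc 0 \<Longrightarrow> computes r xs (reduction n m a (xs ! 0))"
    using rec_total_reduction unfolding rec_total_def by blast
  from this[of "[_]"] show ?thesis by auto
qed

lemma registers_bounded: "\<exists>k. \<forall>ins\<in>set Q. registers ins \<subseteq> {..<k}"
proof -
  have "finite (\<Union>ins\<in>set Q. registers ins)"
  proof (intro finite_UN_I finite_set)
    show "finite (registers ins)" for ins by (cases ins) auto
  qed
  then obtain k where "\<forall>i\<in>(\<Union>ins\<in>set Q. registers ins). i < k"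
    unfolding finite_nat_set_iff_bounded by blast
  then show ?thesis by blast
qed

text \<open>The number \<open>d\<close> encodes all edges except the two that depend on \<open>d\<close> itself, which makes the code
  of the whole instance computable from the input \<open>d\<close> of the simulated machine.\<close>

lemma self_referential_machine:
  obtains k d where "machine (program n m P d) m k d" "d > 0"
    "instance_enc (machine_pta d k (int m + 1) (program n m P d), \<lambda>_. a) = reduction n m a d"
proof -
  let ?Q = "program_tail n m P"
  obtain k where k: "\<forall>ins\<in>set ?Q. registers ins \<subseteq> {..<k}"
    using registers_bounded by blast
  define d where "d = list_encode (map edge_enc (edges_tail k (int m + 1) ?Q))"
  have d: "length ?Q + k + 3 \<le> d"
    using length_le_list_encode[of "map edge_enc (edges_tail k (int m + 1) ?Q)"]
      length_edges_tail[of ?Q k "int m + 1"] by (simp add: d_def)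
  show thesis
  proof (rule that[of d k])
    show "machine (program n m P d) m k d" using k d by (intro machine_program) auto
    show "d > 0" using d by simp
    show "instance_enc (machine_pta d k (int m + 1) (program n m P d), \<lambda>_. a) = reduction n m a d"
      unfolding program_def by (rule instance_enc_machine_pta) (rule d_def)
  qed
qed

text \<open>The preserved value is the least element of \<open>D\<close>. Every other valuation lies
  to its right, and the segment to it meets each right neighbourhood of \<open>a\<close>, where the
  language is known.\<close>

lemma robust_preservation_undecidable:
  fixes a b :: rat
  assumes ab: "0 \<le> a" "a < b" and D: "{a..b} \<subseteq> D" "D \<subseteq> {a..}"
  shows "\<not> robust_preservation_decidable D"
proof
  assume "robust_preservation_decidable D"
  then obtain f where f': "\<forall>i\<in>one_param_instances D. computes f [instance_enc i]
      (if i \<in> {(A, v). robustly_preservable D A v} then 1 else 0)"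
    unfolding robust_preservation_decidable_def decidable_def by blast
  have f: "computes f [instance_enc (A, v)] (if robustly_preservable D A v then 1 else 0)"
    if "(A, v) \<in> one_param_instances D" for A v
    using bspec[OF f' that] by simp
  obtain m' n' where q: "quotient_of a = (m', n')" by (cases "quotient_of a")
  have n': "n' > 0" using quotient_of_denom_pos[OF q] .
  moreover have a_div: "a = of_int m' / of_int n'" using quotient_of_div[OF q] .
  ultimately have m': "m' \<ge> 0" using ab(1) by (simp add: zero_le_divide_iff)
  define n m where "n = nat n'" and "m = nat m'"
  have n: "n > 0" and a: "real_of_rat a = real m / real n"
    using n' m' by (simp_all add: n_def m_def a_div of_rat_divide)
  have a_le: "real_of_rat a \<le> real m"
    using n unfolding a by (simp add: field_simps mult_le_cancel_left1)
  obtain r where r: "\<And>d. computes r [d] (reduction n m a d)"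
    using computes_reduction by blast
  \<comment> \<open>The function \<open>r\<close> depends only on \<open>n\<close>, \<open>m\<close>
    and \<open>a\<close>, so the program is fixed before \<open>k\<close> and \<open>d\<close> are
    chosen for it.\<close>
  define P where "P = compile (Comp f [r]) [0] 1 2"
  obtain k d where mach: "machine (program n m P d) m k d" and d: "d > 0"
    and enc: "instance_enc (machine_pta d k (int m + 1) (program n m P d), \<lambda>_. a) = reduction n m a d"
    by (rule self_referential_machine)
  let ?Q = "program n m P d"
  let ?A = "machine_pta d k (int m + 1) ?Q"
  have A: "machine.A ?Q m k d = ?A" using machine.A_def[OF mach] .
  have params: "params ?A = [0]" by (simp add: machine_pta_def)
  have "(?A, \<lambda>_. a) \<in> one_param_instances D"
    using machine.wf_A[OF mach] ab D unfolding one_param_instances_def valuation_in_def A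
    by (auto simp: params)
  note f = f[OF this]
  define y :: nat where "y = (if robustly_preservable D ?A (\<lambda>_. a) then 1 else 0)"
  have "computes (Comp f [r]) [d] y"
    by (rule computes_Comp[where ys = "[reduction n m a d]"]) (use r f enc in \<open>auto simp: y_def\<close>)
  then have "big_step P ((\<lambda>_. 0)(0 := d)) ((\<lambda>_. 0)(0 := d, 1 := y))"
    unfolding P_def by (rule big_step_compile)
  from eventually_reaches_Halt_iff[OF n d this]
  have halt: "\<forall>\<^sub>F p in at_right (real_of_rat a). reaches_Halt ?Q m p \<longleftrightarrow> y > 0"
    unfolding a .
  have language_iff: "language ?A w = {Inf (\<lambda>_. 0)} \<longleftrightarrow> \<not> reaches_Halt ?Q m (w 0)"
    if "0 \<le> w 0" "w 0 \<le> real m + 1" for w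
  proof -
    interpret machine_run ?Q m k d "w 0" w
      using mach that by (intro machine_run.intro machine_run_axioms.intro) auto
    show ?thesis
    proof (cases "reaches_Halt ?Q m (w 0)")
      case True
      then show ?thesis using language_halt[unfolded A] by simp
    next
      case False
      then show ?thesis using language_no_halt[unfolded A] by simp
    qed
  qed
  have a_ge: "0 \<le> real_of_rat a" using ab(1) by simp
  have language_a: "language ?A (\<lambda>_. of_rat a) = {Inf (\<lambda>_. 0)}"
    by (rule language_iff[THEN iffD2, OF a_ge _ not_reaches_Halt_program[OF n a]]) (use a_le in linarith)
  from halt[unfolded eventually_at_right_field] obtain c where c: "of_rat a < c"
    and halt_c: "\<forall>p>of_rat a. p < c \<longrightarrow> (reaches_Halt ?Q m p \<longleftrightarrow> y > 0)"
    by blast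
  \<comment> \<open>Below \<open>c'\<close> the simulation is faithful, the clock bounds are valid
    and the values stay below \<open>b\<close>, inside \<open>D\<close>.\<close>
  define c' where "c' = min c (min (real m + 1) (of_rat b))"
  have c': "of_rat a < c'" "c' \<le> c" "c' \<le> real m + 1" "c' \<le> of_rat b"
    using c a_le ab(2) by (auto simp: c'_def of_rat_less)
  have language_near: "language ?A w = {Inf (\<lambda>_. 0)} \<longleftrightarrow> y = 0"
    if "of_rat a < w 0" "w 0 < c'" for w
  proof -
    have "0 \<le> w 0" "w 0 \<le> real m + 1" "w 0 < c" using that a_ge c' by linarith+
    then show ?thesis using language_iff[of w] halt_c that(1) by simp
  qed
  show False
  proof (cases "robustly_preservable D ?A (\<lambda>_. a)")
    case True
    then obtain v' where v': "v' 0 \<in> D" "v' 0 \<noteq> a" and eq: "\<And>t. t \<in> {0..1::real} \<Longrightarrow>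
        language ?A (\<lambda>p. t * of_rat a + (1 - t) * of_rat (v' p)) = language ?A (\<lambda>_. of_rat a)"
      unfolding robustly_preservable_def valuation_in_def params by auto
    then have v'_a: "of_rat a < (of_rat (v' 0) :: real)" using D(2) by (auto simp: of_rat_less)
    \<comment> \<open>A point of the segment close to \<open>a\<close>, with coordinate
      \<open>t\<close>: preservation there gives \<open>y = 0\<close>, although the answer was
      positive.\<close>
    define q where "q = min (of_rat (v' 0)) ((of_rat a + c') / 2)"
    have q: "of_rat a < q" "q < c'" "q \<le> of_rat (v' 0)" using v'_a c'(1) by (simp_all add: q_def min_less_iff_disj)
    define t where "t = (of_rat (v' 0) - q) / (of_rat (v' 0) - of_rat a)"
    have t: "t \<in> {0..1}" using q v'_a by (simp add: t_def field_simps)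
    have "t * (of_rat (v' 0) - of_rat a) = of_rat (v' 0) - q" using v'_a by (auto simp: t_def)
    then have "t * of_rat a + (1 - t) * of_rat (v' 0) = q" by (simp add: algebra_simps)
    then have "y = 0"
      using language_near[of "\<lambda>p. t * of_rat a + (1 - t) * of_rat (v' p)"] q eq[OF t] language_a
      by simp
    then show False using True by (simp add: y_def)
  next
    case False
    then have y: "y = 0" by (simp add: y_def)
    \<comment> \<open>The other end of the segment must be rational, while the points between may be
      any reals.\<close>
    obtain q where q: "of_rat a < (of_rat q :: real)" "of_rat q < c'"
      using of_rat_dense[OF c'(1)] by blast
    have "language ?A (\<lambda>_. t * of_rat a + (1 - t) * of_rat q) = language ?A (\<lambda>_. of_rat a)"
      if "t \<in> {0..1}" for t
    proof (cases "t = 1")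
      case True
      then show ?thesis by simp
    next
      case False
      then have "0 < (1 - t) * (of_rat q - of_rat a)" "0 \<le> t * (of_rat q - of_rat a)"
        using that q by auto
      then have "of_rat a < t * of_rat a + (1 - t) * of_rat q"
        "t * of_rat a + (1 - t) * of_rat q \<le> of_rat q"
        by (simp_all add: algebra_simps)
      then show ?thesis
        using language_near[of "\<lambda>_. t * of_rat a + (1 - t) * of_rat q"] y q language_a by simp
    qed
    moreover have "a < q" "q < b" using q c'(4) by (auto simp: of_rat_less dest: less_le_trans)
    ultimately have "robustly_preservable D ?A (\<lambda>_. a)"
      using D(1) unfolding robustly_preservable_def valuation_in_def params
      by (intro exI[of _ "\<lambda>_. q"]) auto
    then show False using False by simp
  qed
qed

theorem theorem3p10:
  "\<not> robust_preservation_decidable {0..} \<and>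
   (\<forall>a b :: rat. 0 \<le> a \<longrightarrow> a < b \<longrightarrow> \<not> robust_preservation_decidable {a..b})"
  using robust_preservation_undecidable[of 0 1 "{0..}"] robust_preservation_undecidable by auto

end
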